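(* Let $\Omega\subset\mathbb R^n$ be nonempty and open, let $f\in BV(\Omega)$, and write the Lebesgue decomposition of $Df$ with respect to $\mathcal L^n$ as $Df=f^a\,\mathcal L^n+D^sf$, where $f^a=(f^a_1,\dots,f^a_n)\in L^1(\Omega;\mathbb R^n)$ and $D^sf$ is singular with respect to $\mathcal L^n$. Let $1\le i\le n$ and let $g$ be any function equal to $f$ $\mathcal L^n$-almost everywhere for which the ordinary partial derivative $\partial g/\partial x_i$ exists $\mathcal L^n$-almost everywhere in $\Omega$. Then $\partial g/\partial x_i=f^a_i$ $\mathcal L^n$-almost everywhere in $\Omega$.
   Context: $BV(\Omega)$ is the set of $f\in L^1(\Omega)$ whose distributional partial derivatives $D_1f,\dots,D_nf$ are finite signed Radon measures on $\Omega$ of finite total variation; $Df=(D_1f,\dots,D_nf)$ is an $\mathbb R^n$-valued measure, $\mathcal L^n$ is Lebesgue measure. *)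

theory Defs
  imports "HOL-Analysis.Analysis"
begin

definition has_partial :: "'n::finite \<Rightarrow> (real^'n \<Rightarrow> real) \<Rightarrow> real^'n \<Rightarrow> bool" where
  "has_partial i g x \<longleftrightarrow> (\<lambda>t. g (x + t *\<^sub>R axis i 1)) differentiable (at 0)"

definition partial_at :: "'n::finite \<Rightarrow> (real^'n \<Rightarrow> real) \<Rightarrow> real^'n \<Rightarrow> real" where
  "partial_at i g x = deriv (\<lambda>t. g (x + t *\<^sub>R axis i 1)) 0"

fun iter_partial :: "'n::finite list \<Rightarrow> (real^'n \<Rightarrow> real) \<Rightarrow> real^'n \<Rightarrow> real" where
  "iter_partial [] g = g"
| "iter_partial (i # is) g = partial_at i (iter_partial is g)"

definition smooth_fun :: "(real^'n::finite \<Rightarrow> real) \<Rightarrow> bool" where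
  "smooth_fun g \<longleftrightarrow> (\<forall>is. continuous_on UNIV (iter_partial is g)
                       \<and> (\<forall>i x. has_partial i (iter_partial is g) x))"

definition test_fun :: "(real^'n::finite) set \<Rightarrow> (real^'n \<Rightarrow> real) \<Rightarrow> bool" where
  "test_fun \<Omega> \<phi> \<longleftrightarrow> smooth_fun \<phi> \<and> compact (closure {x. \<phi> x \<noteq> 0})
                      \<and> closure {x. \<phi> x \<noteq> 0} \<subseteq> \<Omega>"

definition fin_meas_on :: "(real^'n::finite) set \<Rightarrow> (real^'n) measure \<Rightarrow> bool" where
  "fin_meas_on \<Omega> \<mu> \<longleftrightarrow> sets \<mu> = sets borel \<and> finite_measure \<mu> \<and> emeasure \<mu> (UNIV - \<Omega>) = 0"

text \<open>The finite signed Radon measure mu_p - mu_n on Omega is the distributional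
  partial derivative D_i f.\<close>
definition distr_partial :: "(real^'n::finite) set \<Rightarrow> (real^'n \<Rightarrow> real) \<Rightarrow> 'n
    \<Rightarrow> (real^'n) measure \<Rightarrow> (real^'n) measure \<Rightarrow> bool" where
  "distr_partial \<Omega> f i \<mu>p \<mu>n \<longleftrightarrow> fin_meas_on \<Omega> \<mu>p \<and> fin_meas_on \<Omega> \<mu>n \<and>
     (\<forall>\<phi>. test_fun \<Omega> \<phi> \<longrightarrow>
        (LINT x:\<Omega>|lebesgue. f x * partial_at i \<phi> x) = - ((\<integral>x. \<phi> x \<partial>\<mu>p) - (\<integral>x. \<phi> x \<partial>\<mu>n)))"

definition BV :: "(real^'n::finite) set \<Rightarrow> (real^'n \<Rightarrow> real) \<Rightarrow> bool" where
  "BV \<Omega> f \<longleftrightarrow> set_integrable lebesgue \<Omega> f \<and> (\<forall>i. \<exists>\<mu>p \<mu>n. distr_partial \<Omega> f i \<mu>p \<mu>n)"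

text \<open>fa is the density of the absolutely continuous part of the signed measure
  mu_p - mu_n: i.e. (mu_p - mu_n) - fa L^n is singular w.r.t. L^n (concentrated on
  a Lebesgue null set N).\<close>
definition abs_cont_density :: "(real^'n::finite) set \<Rightarrow> (real^'n) measure \<Rightarrow> (real^'n) measure
    \<Rightarrow> (real^'n \<Rightarrow> real) \<Rightarrow> bool" where
  "abs_cont_density \<Omega> \<mu>p \<mu>n fa \<longleftrightarrow> set_integrable lebesgue \<Omega> fa \<and>
     (\<exists>N \<in> null_sets lebesgue. \<forall>A \<in> sets borel. A \<subseteq> \<Omega> - N \<longrightarrow>
        measure \<mu>p A - measure \<mu>n A = (LINT x:A|lebesgue. fa x))"

end

theory Submission
  imports Defs
begin

text \<open>
  Only limits of the difference quotients of \<open>f\<close> along one sequence \<open>h\<^sub>k\<close> decreasing to \<open>0\<close> matter: translates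
  of null sets are null, so wherever the classical partial derivative of \<open>g\<close> exists it is almost
  everywhere the limit of \<open>(f (x + h\<^sub>k e) - f x) / h\<^sub>k\<close>. Testing the weak derivative with a bump
  function averaged over segments in direction \<open>e\<close> shows that the integral of this quotient over a Borel
  set \<open>B\<close> is the mean over \<open>0 \<le> s \<le> h\<^sub>k\<close> of the measures of \<open>B + s e\<close> under \<open>D\<^sub>i f\<close>.
  Let \<open>B\<close> be compact and disjoint from the null set \<open>N\<close> that carries the singular part. A compact subset \<open>K\<close>
  of \<open>N\<close> carries all but \<open>\<epsilon>\<close> of the singular part and has positive distance from \<open>B\<close>, so the
  mean tends to the integral of the density over \<open>B\<close>. If the quotients are bounded
  on \<open>B\<close>, dominated convergence identifies the integrals over \<open>B\<close> of their limit and of the density;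
  sufficiently many such \<open>B\<close> exist by inner regularity of Lebesgue measure.
\<close>

section \<open>Smooth bump functions\<close>

fun cont_diff :: "nat \<Rightarrow> (real \<Rightarrow> real) \<Rightarrow> bool" where
  "cont_diff 0 u \<longleftrightarrow> continuous_on UNIV u"
| "cont_diff (Suc n) u \<longleftrightarrow> (\<exists>v. (\<forall>x. (u has_real_derivative v x) (at x)) \<and> cont_diff n v)"

lemma cont_diff_Suc_imp: "cont_diff (Suc n) u \<Longrightarrow> cont_diff n u"
proof (induction n arbitrary: u)
  case 0
  then obtain v where "\<And>x. (u has_real_derivative v x) (at x)" by auto
  then show ?case
    using DERIV_continuous_on[OF has_field_derivative_at_within] by simp blast
next
  case (Suc n)
  from Suc.prems obtain v where "\<forall>x. (u has_real_derivative v x) (at x)" "cont_diff (Suc n) v"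
    by (metis cont_diff.simps(2))
  with Suc.IH[of v] show ?case by (subst cont_diff.simps(2)) blast
qed

lemma cont_diff_const: "cont_diff n (\<lambda>_. c)"
proof (induction n arbitrary: c)
  case (Suc n)
  have "\<forall>x. ((\<lambda>_. c) has_real_derivative 0) (at x)" by simp
  with Suc[of 0] show ?case by (subst cont_diff.simps(2)) (rule exI[of _ "\<lambda>_. 0"], simp)
qed simp

lemma cont_diff_add: "cont_diff n u \<Longrightarrow> cont_diff n v \<Longrightarrow> cont_diff n (\<lambda>x. u x + v x)"
proof (induction n arbitrary: u v)
  case 0
  then show ?case by (auto intro: continuous_intros)
next
  case (Suc n)
  then obtain u' v' where "\<forall>x. (u has_real_derivative u' x) (at x)" "cont_diff n u'"
    "\<forall>x. (v has_real_derivative v' x) (at x)" "cont_diff n v'" by auto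
  with Suc.IH show ?case
    by (auto intro!: exI[of _ "\<lambda>x. u' x + v' x"] DERIV_add)
qed

lemma cont_diff_mult: "cont_diff n u \<Longrightarrow> cont_diff n v \<Longrightarrow> cont_diff n (\<lambda>x. u x * v x)"
proof (induction n arbitrary: u v)
  case 0
  then show ?case by (auto intro: continuous_intros)
next
  case (Suc n)
  then have uv: "cont_diff n u" "cont_diff n v" using cont_diff_Suc_imp by blast+
  from Suc.prems obtain u' v' where d: "\<And>x. (u has_real_derivative u' x) (at x)" "cont_diff n u'"
    "\<And>x. (v has_real_derivative v' x) (at x)" "cont_diff n v'" by auto
  have "cont_diff n (\<lambda>x. u' x * v x + v' x * u x)"
    by (intro cont_diff_add Suc.IH d uv)
  moreover have "((\<lambda>x. u x * v x) has_real_derivative (u' x * v x + v' x * u x)) (at x)" for x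
    using d by (intro DERIV_mult)
  ultimately show ?case by (auto intro!: exI[of _ "\<lambda>x. u' x * v x + v' x * u x"])
qed

lemma cont_diff_affine: "cont_diff n u \<Longrightarrow> cont_diff n (\<lambda>x. u (c * x + d))"
proof (induction n arbitrary: u)
  case 0
  then show ?case by (auto intro!: continuous_on_compose2[of UNIV u] continuous_intros)
next
  case (Suc n)
  from Suc.prems obtain u' where d: "\<And>x. (u has_real_derivative u' x) (at x)" "cont_diff n u'" by auto
  have "cont_diff n (\<lambda>x. u' (c * x + d) * c)"
    by (intro cont_diff_mult cont_diff_const Suc.IH d)
  moreover have "((\<lambda>x. u (c * x + d)) has_real_derivative (u' (c * x + d) * c)) (at x)" for x
    by (rule DERIV_chain2[where f=u and g="\<lambda>x. c * x + d"]) (auto intro!: d derivative_eq_intros)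
  ultimately show ?case by (auto intro!: exI[of _ "\<lambda>x. u' (c * x + d) * c"])
qed

definition smooth1 :: "(real \<Rightarrow> real) \<Rightarrow> bool" where
  "smooth1 u \<longleftrightarrow> (\<forall>n. cont_diff n u)"

text \<open>The witness in \<open>cont_diff\<close> could vary with the order; uniqueness of
  derivatives forces each one to be \<open>deriv u\<close>, so one function serves all
  orders.\<close>

lemma smooth1_derivative:
  assumes "smooth1 u"
  shows "(u has_real_derivative deriv u x) (at x)" "smooth1 (deriv u)"
proof -
  have *: "(\<forall>x. (u has_real_derivative deriv u x) (at x)) \<and> cont_diff n (deriv u)" for n
  proof -
    from assms have "cont_diff (Suc n) u" unfolding smooth1_def by blast
    then obtain v where v: "\<And>x. (u has_real_derivative v x) (at x)" "cont_diff n v" by auto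
    then have "deriv u = v" by (auto intro: DERIV_imp_deriv)
    with v show ?thesis by auto
  qed
  then show "(u has_real_derivative deriv u x) (at x)" "smooth1 (deriv u)"
    by (auto simp: smooth1_def)
qed

lemma smooth1_if_derivative:
  assumes "\<And>x. (u has_real_derivative v x) (at x)" "smooth1 v"
  shows "smooth1 u"
proof -
  have "cont_diff (Suc n) u" for n using assms by (auto simp: smooth1_def)
  then show ?thesis using cont_diff_Suc_imp unfolding smooth1_def by blast
qed

lemma smooth1_continuous: "smooth1 u \<Longrightarrow> continuous_on UNIV u"
  unfolding smooth1_def by (metis cont_diff.simps(1))

lemma smooth1_mult: "smooth1 u \<Longrightarrow> smooth1 v \<Longrightarrow> smooth1 (\<lambda>x. u x * v x)"
  by (simp add: smooth1_def cont_diff_mult)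

lemma smooth1_diff: "smooth1 u \<Longrightarrow> smooth1 v \<Longrightarrow> smooth1 (\<lambda>x. u x - v x)"
  using cont_diff_add[OF _ cont_diff_mult[OF cont_diff_const[of _ "-1"]]] by (simp add: smooth1_def)

lemma smooth1_affine: "smooth1 u \<Longrightarrow> smooth1 (\<lambda>x. u (c * x + d))"
  by (simp add: smooth1_def cont_diff_affine)

section \<open>Functions exponentially flat at the origin\<close>

lemma tendsto_poly_mult_exp_minus:
  "((\<lambda>y. poly p y * exp (- y)) \<longlongrightarrow> (0::real)) at_top"
proof -
  have "((\<lambda>y. \<Sum>i\<le>degree p. coeff p i * (y ^ i / exp y)) \<longlongrightarrow> (\<Sum>i\<le>degree p. coeff p i * 0)) at_top"
    by (intro tendsto_intros tendsto_power_div_exp_0)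
  then show ?thesis
    by (simp add: poly_altdef sum_distrib_right exp_minus divide_inverse mult.assoc)
qed

text \<open>The functions \<open>p(1/x) exp(-1/x)\<close>, extended by \<open>0\<close>, are closed under differentiation.\<close>

definition flat :: "real poly \<Rightarrow> real \<Rightarrow> real" where
  "flat p x = (if x > 0 then poly p (1/x) * exp (- (1/x)) else 0)"

text \<open>With y = 1/x, differentiating p(y) exp(-y) in x gives (p(y) - p'(y)) y^2 exp(-y), and
  \<open>[:0,0,1:]\<close> is y^2. At the origin the difference quotient from the right is y p(y)
  exp(-y) with y tending to infinity, so it tends to 0.\<close>

lemma flat_has_derivative:
  "(flat p has_real_derivative flat ((p - pderiv p) * [:0,0,1:]) x) (at x)"
proof -
  consider "x > 0" | "x < 0" | "x = 0" by linarith
  then show ?thesis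
  proof cases
    case 1
    have "((\<lambda>x. poly p (1/x) * exp (- (1/x))) has_real_derivative
        flat ((p - pderiv p) * [:0,0,1:]) x) (at x)"
      using 1 unfolding flat_def
      by (auto intro!: derivative_eq_intros DERIV_chain2[OF poly_DERIV]
          simp: field_simps power2_eq_square)
    then show ?thesis
      by (rule has_field_derivative_transform_within_open[of _ _ _ "{0<..}"])
        (use 1 in \<open>auto simp: flat_def\<close>)
  next
    case 2
    have "((\<lambda>x. 0) has_real_derivative flat ((p - pderiv p) * [:0,0,1:]) x) (at x)"
      using 2 unfolding flat_def by auto
    then show ?thesis
      by (rule has_field_derivative_transform_within_open[of _ _ _ "{..<0}"])
        (use 2 in \<open>auto simp: flat_def\<close>)
  next
    case 3
    have "((\<lambda>h. poly (p * [:0,1:]) (inverse h) * exp (- (inverse h))) \<longlongrightarrow> 0) (at_right 0)"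
      by (rule filterlim_compose[OF tendsto_poly_mult_exp_minus filterlim_inverse_at_top_right])
    then have r: "((\<lambda>h. flat p h / h) \<longlongrightarrow> 0) (at_right 0)"
      by (rule Lim_transform_eventually)
        (auto simp: eventually_at_filter flat_def field_simps)
    have l: "((\<lambda>h. flat p h / h) \<longlongrightarrow> 0) (at_left 0)"
      by (rule Lim_transform_eventually[of "\<lambda>_. 0"])
        (auto simp: eventually_at_filter flat_def)
    have "((\<lambda>h. flat p h / h) \<longlongrightarrow> 0) (at 0)"
      using l r by (simp add: filterlim_at_split)
    then show ?thesis using 3 by (simp add: DERIV_def flat_def)
  qed
qed

lemma smooth1_flat: "smooth1 (flat p)"
proof -
  have "cont_diff n (flat p)" for n
  proof (induction n arbitrary: p)
    case 0
    show ?case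
      using DERIV_continuous_on[OF has_field_derivative_at_within[OF flat_has_derivative]] by simp
  next
    case (Suc n)
    have "\<forall>x. (flat p has_real_derivative flat ((p - pderiv p) * [:0,0,1:]) x) (at x)"
      using flat_has_derivative by blast
    with Suc show ?case unfolding cont_diff.simps(2) by (intro exI conjI)
  qed
  then show ?thesis by (simp add: smooth1_def)
qed

section \<open>Bumps approximating indicators of open intervals\<close>

definition bump :: "nat \<Rightarrow> real \<Rightarrow> real \<Rightarrow> real \<Rightarrow> real" where
  "bump k a b t = flat 1 (real (Suc k) * (t - a)) * flat 1 (real (Suc k) * (b - t))"

lemma smooth1_bump: "smooth1 (bump k a b)"
proof -
  have "smooth1 (\<lambda>t. flat 1 (real (Suc k) * t + (- real (Suc k) * a)) *
      flat 1 ((- real (Suc k)) * t + (real (Suc k) * b)))"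
    by (intro smooth1_mult smooth1_affine smooth1_flat)
  moreover have "bump k a b = (\<lambda>t. flat 1 (real (Suc k) * t + (- real (Suc k) * a)) *
      flat 1 ((- real (Suc k)) * t + (real (Suc k) * b)))"
    unfolding bump_def[abs_def] right_diff_distrib by (simp add: add.commute del: of_nat_Suc)
  ultimately show ?thesis by simp
qed

lemma flat_1_nonneg: "0 \<le> flat 1 x"
  by (simp add: flat_def)

lemma flat_1_le_1: "flat 1 x \<le> 1"
  by (simp add: flat_def)

lemma bump_nonneg: "0 \<le> bump k a b t"
  unfolding bump_def by (intro mult_nonneg_nonneg flat_1_nonneg)

lemma bump_le_1: "bump k a b t \<le> 1"
  unfolding bump_def by (intro mult_le_one flat_1_nonneg flat_1_le_1)

lemma bump_outside:
  assumes "t \<notin> {a<..<b}" shows "bump k a b t = 0"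
proof -
  have "real (Suc k) * (t - a) \<le> 0 \<or> real (Suc k) * (b - t) \<le> 0"
    using assms by (intro disj_forward[OF _ mult_nonneg_nonpos mult_nonneg_nonpos]) auto
  then show ?thesis unfolding bump_def flat_def by (auto simp del: of_nat_Suc)
qed

lemma tendsto_flat_Suc_mult:
  assumes "x > 0" shows "(\<lambda>k. flat 1 (real (Suc k) * x)) \<longlonglongrightarrow> 1"
proof -
  have "(\<lambda>k. exp (- (inverse (real (Suc k)) * (1/x)))) \<longlonglongrightarrow> exp (- (0 * (1/x)))"
    by (intro tendsto_intros LIMSEQ_inverse_real_of_nat)
  moreover have "flat 1 (real (Suc k) * x) = exp (- (inverse (real (Suc k)) * (1/x)))" for k
    using assms unfolding flat_def by (subst if_P) (auto simp: divide_inverse)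
  ultimately show ?thesis by simp
qed

text \<open>Inside the interval both arguments of \<open>flat 1\<close> grow without bound in
  \<open>k\<close>, and exp(-1/y) tends to 1. Elsewhere, endpoints included, every bump
  vanishes.\<close>

lemma bump_tendsto: "(\<lambda>k. bump k a b t) \<longlonglongrightarrow> indicator {a<..<b} t"
proof (cases "t \<in> {a<..<b}")
  case True
  then have "(\<lambda>k. bump k a b t) \<longlonglongrightarrow> 1 * 1"
    unfolding bump_def by (intro tendsto_mult tendsto_flat_Suc_mult) auto
  with True show ?thesis by simp
next
  case False
  then show ?thesis by (simp add: bump_outside)
qed

section \<open>Tensor products of one-variable functions\<close>

definition prodfun :: "('n::finite \<Rightarrow> real \<Rightarrow> real) \<Rightarrow> real^'n \<Rightarrow> real" where
  "prodfun b x = (\<Prod>j\<in>UNIV. b j (x $ j))"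

lemma prodfun_along_axis:
  "prodfun b (x + t *\<^sub>R axis i 1) = b i (x $ i + t) * (\<Prod>j\<in>-{i}. b j (x $ j))"
proof -
  have "prodfun b (x + t *\<^sub>R axis i 1) =
      b i (x $ i + t) * (\<Prod>j\<in>UNIV-{i}. b j ((x + t *\<^sub>R axis i 1) $ j))"
    unfolding prodfun_def by (subst prod.remove[of _ i]) auto
  also have "(\<Prod>j\<in>UNIV-{i}. b j ((x + t *\<^sub>R axis i 1) $ j)) = (\<Prod>j\<in>-{i}. b j (x $ j))"
    by (rule prod.cong) (auto simp: axis_def)
  finally show ?thesis .
qed

lemma prodfun_has_partial:
  assumes "\<And>t. (b i has_real_derivative v t) (at t)"
  shows "has_partial i (prodfun b) x" "partial_at i (prodfun b) x = prodfun (b(i := v)) x"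
proof -
  have "((\<lambda>t. b i (x $ i + t) * (\<Prod>j\<in>-{i}. b j (x $ j))) has_real_derivative
      v (x $ i) * (\<Prod>j\<in>-{i}. b j (x $ j))) (at 0)"
    using assms DERIV_shift[of "b i" "v (x$i)" 0 "x$i"]
    by (intro DERIV_cmult_right) (simp add: add.commute)
  moreover have "v (x $ i) * (\<Prod>j\<in>-{i}. b j (x $ j)) = prodfun (b(i := v)) x"
    using prodfun_along_axis[of "b(i:=v)" x 0 i] by simp
  ultimately have *: "((\<lambda>t. prodfun b (x + t *\<^sub>R axis i 1)) has_real_derivative
     prodfun (b(i := v)) x) (at 0)"
    by (simp add: prodfun_along_axis)
  then show "has_partial i (prodfun b) x"
    unfolding has_partial_def by (auto simp: real_differentiable_def)
  from * show "partial_at i (prodfun b) x = prodfun (b(i := v)) x"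
    unfolding partial_at_def by (rule DERIV_imp_deriv)
qed

lemma continuous_on_prodfun:
  assumes "\<And>j. continuous_on UNIV (b j)"
  shows "continuous_on UNIV (prodfun b)"
  unfolding prodfun_def
  by (intro continuous_on_prod continuous_on_compose2[OF assms] continuous_intros) auto

text \<open>Partial differentiation in direction \<open>i\<close> only replaces factor
  \<open>i\<close> by its derivative, so all iterated partial derivatives are again products of
  smooth factors.\<close>

lemma smooth_fun_prodfun:
  assumes "\<And>j. smooth1 (b j)"
  shows "smooth_fun (prodfun b)"
proof -
  have "\<exists>b'. (\<forall>j. smooth1 (b' j)) \<and> iter_partial is (prodfun b) = prodfun b'" for "is"
  proof (induction "is")
    case Nil
    then show ?case using assms by auto
  next
    case (Cons i "is")
    then obtain b' where b': "\<And>j. smooth1 (b' j)" "iter_partial is (prodfun b) = prodfun b'"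
      by auto
    have "iter_partial (i # is) (prodfun b) = prodfun (b'(i := deriv (b' i)))"
      unfolding fun_eq_iff using prodfun_has_partial(2)[of b' i "deriv (b' i)"] smooth1_derivative(1)[OF b'(1)[of i]] b'(2)
      by auto
    moreover have "\<forall>j. smooth1 ((b'(i := deriv (b' i))) j)"
      using b'(1) smooth1_derivative(2) by simp
    ultimately show ?case by blast
  qed
  moreover have "continuous_on UNIV (prodfun b')" "has_partial i (prodfun b') x"
    if "\<And>j. smooth1 (b' j)" for b' :: "'n::finite \<Rightarrow> real \<Rightarrow> real" and i x
    using that continuous_on_prodfun[of b'] smooth1_continuous
      prodfun_has_partial(1)[of b' i] smooth1_derivative(1) by blast+
  ultimately show ?thesis
    unfolding smooth_fun_def by metis
qed

lemma test_fun_prodfun: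
  assumes "\<And>j. smooth1 (b j)" and supp: "\<And>j t. t \<notin> {l $ j..u $ j} \<Longrightarrow> b j t = 0"
    and "cbox l u \<subseteq> \<Omega>"
  shows "test_fun \<Omega> (prodfun b)"
proof -
  have "{x. prodfun b x \<noteq> 0} \<subseteq> cbox l u"
    using supp by (force simp: prodfun_def mem_box_cart)
  then have "closure {x. prodfun b x \<noteq> 0} \<subseteq> cbox l u"
    by (rule closure_minimal) (rule closed_cbox)
  moreover from this have "compact (closure {x. prodfun b x \<noteq> 0})"
    by (meson bounded_cbox bounded_subset closed_closure compact_eq_bounded_closed)
  ultimately show ?thesis
    using assms smooth_fun_prodfun unfolding test_fun_def by blast
qed

section \<open>Averaging measures along segments\<close>

text \<open>Up to normalisation this is the convolution of \<open>M\<close> with the uniform law on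
  the segment from -h e to 0. Without the factor 1/h it is the adjoint of integrating a test
  function over such segments.\<close>

definition smear :: "'a::euclidean_space \<Rightarrow> real \<Rightarrow> 'a measure \<Rightarrow> 'a measure" where
  "smear e h M = distr (M \<Otimes>\<^sub>M density lborel (indicator {0..h})) borel (\<lambda>(y, s). y - s *\<^sub>R e)"

lemma sets_smear [simp, measurable_cong]: "sets (smear e h M) = sets borel"
  by (simp add: smear_def)

lemma finite_measure_density_Icc: "finite_measure (density lborel (indicator {0..h::real}))"
  by (rule finite_measureI) (cases "0 \<le> h"; simp add: emeasure_density nn_integral_indicator)

lemma finite_measure_pair:
  assumes "finite_measure M" "finite_measure N"
  shows "finite_measure (M \<Otimes>\<^sub>M N)"
proof -
  interpret M: finite_measure M by fact
  interpret N: finite_measure N by fact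
  show ?thesis
    by (rule finite_measureI)
      (simp add: space_pair_measure N.emeasure_pair_measure_Times ennreal_mult_eq_top_iff)
qed

lemma finite_measure_smear:
  assumes "finite_measure M" and [measurable_cong]: "sets M = sets borel"
  shows "finite_measure (smear e h M)"
  unfolding smear_def
  by (intro finite_measure.finite_measure_distr finite_measure_pair assms finite_measure_density_Icc)
    measurable

text \<open>Fubini in both orders. The first form integrates a segment integral of \<psi>, as occurs
  in the weak derivative; the second is an integral over the shift \<open>s\<close>, which yields
  masses of translates when \<psi> is an indicator.\<close>

lemma integral_smear:
  fixes \<psi> :: "'a::euclidean_space \<Rightarrow> real"
  assumes "finite_measure M" and [measurable_cong]: "sets M = sets borel"
    and [measurable]: "\<psi> \<in> borel_measurable borel" and bound: "\<And>x. \<bar>\<psi> x\<bar> \<le> C"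
  shows "(\<integral>x. \<psi> x \<partial>smear e h M) = (\<integral>y. (\<integral>s. indicator {0..h} s * \<psi> (y - s *\<^sub>R e) \<partial>lborel) \<partial>M)"
    and "(\<integral>x. \<psi> x \<partial>smear e h M) = (\<integral>s. indicator {0..h} s * (\<integral>y. \<psi> (y - s *\<^sub>R e) \<partial>M) \<partial>lborel)"
    and "integrable lborel (\<lambda>s. indicator {0..h} s * (\<integral>y. \<psi> (y - s *\<^sub>R e) \<partial>M))"
proof -
  let ?L = "density lborel (indicator {0..h::real})"
  interpret M: finite_measure M by fact
  interpret L: finite_measure ?L by (rule finite_measure_density_Icc)
  interpret pair_sigma_finite M ?L ..
  interpret P: finite_measure "M \<Otimes>\<^sub>M ?L"
    by (rule finite_measure_pair) unfold_locales
  have L: "?L = density lborel (\<lambda>x. ennreal (indicator {0..h} x))"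
    by (simp add: ennreal_indicator)
  have int: "integrable (M \<Otimes>\<^sub>M ?L) (\<lambda>(y, s). \<psi> (y - s *\<^sub>R e))"
    by (rule P.integrable_const_bound[where B=C]) (use bound in \<open>auto simp: split_beta'\<close>)
  have eq: "(\<integral>x. \<psi> x \<partial>smear e h M) = (\<integral>(y, s). \<psi> (y - s *\<^sub>R e) \<partial>(M \<Otimes>\<^sub>M ?L))"
    unfolding smear_def by (subst integral_distr) (auto simp: split_beta')
  also have "\<dots> = (\<integral>y. (\<integral>s. \<psi> (y - s *\<^sub>R e) \<partial>?L) \<partial>M)"
    using integral_fst[OF int] by simp
  also have "\<dots> = (\<integral>y. (\<integral>s. indicator {0..h} s * \<psi> (y - s *\<^sub>R e) \<partial>lborel) \<partial>M)"
    unfolding L by (subst integral_density) auto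
  finally show "(\<integral>x. \<psi> x \<partial>smear e h M) = (\<integral>y. (\<integral>s. indicator {0..h} s * \<psi> (y - s *\<^sub>R e) \<partial>lborel) \<partial>M)" .
  have "(\<integral>x. \<psi> x \<partial>smear e h M) = (\<integral>s. (\<integral>y. \<psi> (y - s *\<^sub>R e) \<partial>M) \<partial>?L)"
    using integral_snd[OF int] eq by simp
  also have "\<dots> = (\<integral>s. indicator {0..h} s * (\<integral>y. \<psi> (y - s *\<^sub>R e) \<partial>M) \<partial>lborel)"
    unfolding L by (subst integral_density) auto
  finally show "(\<integral>x. \<psi> x \<partial>smear e h M) = (\<integral>s. indicator {0..h} s * (\<integral>y. \<psi> (y - s *\<^sub>R e) \<partial>M) \<partial>lborel)" .
  show "integrable lborel (\<lambda>s. indicator {0..h} s * (\<integral>y. \<psi> (y - s *\<^sub>R e) \<partial>M))"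
    using integrable_snd[OF int] unfolding L by (subst (asm) integrable_density) auto
qed

lemma continuous_has_antiderivative:
  fixes u :: "real \<Rightarrow> real"
  assumes "continuous_on UNIV u"
  obtains U where "\<And>t. (U has_real_derivative u t) (at t)"
proof -
  have "isCont u t" for t
    using assms by (simp add: continuous_on_eq_continuous_at)
  then obtain U where "\<And>t. (U has_vector_derivative u t) (at t)"
    using einterval_antiderivative[of "-\<infinity>" "\<infinity>" u] by auto
  then show thesis
    using that by (auto simp: has_real_derivative_iff_has_vector_derivative)
qed

section \<open>Testing the weak derivative with segment integrals of bumps\<close>

lemma prodfun_bump_nonneg: "0 \<le> prodfun (\<lambda>j. bump k (a j) (b j)) x"
  and prodfun_bump_le_1: "prodfun (\<lambda>j. bump k (a j) (b j)) x \<le> 1"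
  unfolding prodfun_def by (auto intro!: prod_nonneg prod_le_1 bump_nonneg bump_le_1)

lemma prodfun_bump_tendsto:
  "(\<lambda>k. prodfun (\<lambda>j. bump k (a $ j) (b $ j)) x) \<longlonglongrightarrow> indicator (box a b) x"
proof -
  have "indicator (box a b) x = (\<Prod>j\<in>UNIV. indicator {a $ j<..<b $ j} (x $ j) :: real)"
    by (auto simp: indicator_def mem_box_cart prod_zero_iff)
  then show ?thesis
    unfolding prodfun_def by (auto intro!: tendsto_prod bump_tendsto)
qed

text \<open>In the application \<open>F\<close> is a Borel version of \<open>f\<close> extended by
  zero, so that translates and product measures can be formed on the whole space.\<close>

locale weak_partial =
  fixes \<Omega> :: "(real^'n::finite) set" and F :: "real^'n \<Rightarrow> real" and i :: 'n
    and \<mu> \<nu> :: "(real^'n) measure"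
  assumes integrable_F: "integrable lborel F"
    and sets_\<mu> [measurable_cong]: "sets \<mu> = sets borel"
    and sets_\<nu> [measurable_cong]: "sets \<nu> = sets borel"
    and finite_\<mu>: "finite_measure \<mu>" and finite_\<nu>: "finite_measure \<nu>"
    and weak: "\<And>\<phi>. test_fun \<Omega> \<phi> \<Longrightarrow>
      (\<integral>x. F x * partial_at i \<phi> x \<partial>lborel) = - ((\<integral>x. \<phi> x \<partial>\<mu>) - (\<integral>x. \<phi> x \<partial>\<nu>))"
begin

abbreviation e where "e \<equiv> axis i (1::real)"

text \<open>The test function \<Phi>(y) is the integral of \<psi>(y - s e) over 0 \<le> s \<le> h.
  Its derivative along e is \<psi>(x) - \<psi>(x - h e), and its integral against \<mu> or \<nu> is
  that of \<psi> against the smeared measure. The minus sign in the weak identity puts \<nu>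
  first.\<close>

lemma difference_bump:
  fixes k :: nat
  assumes h: "h \<ge> 0" and sub: "cbox a (b + h *\<^sub>R e) \<subseteq> \<Omega>"
  defines "\<psi> \<equiv> prodfun (\<lambda>j. bump k (a $ j) (b $ j))"
  shows "(\<integral>x. F x * (\<psi> x - \<psi> (x - h *\<^sub>R e)) \<partial>lborel) =
    (\<integral>x. \<psi> x \<partial>smear e h \<nu>) - (\<integral>x. \<psi> x \<partial>smear e h \<mu>)"
proof -
  define \<beta> where "\<beta> j = bump k (a $ j) (b $ j)" for j
  have \<psi>: "\<psi> = prodfun \<beta>" by (simp add: \<psi>_def \<beta>_def[abs_def])
  have smooth: "smooth1 (\<beta> j)" for j
    by (simp add: \<beta>_def smooth1_bump)
  obtain U where U: "\<And>t. (U has_real_derivative \<beta> i t) (at t)"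
    using continuous_has_antiderivative[OF smooth1_continuous[OF smooth[of i]]] by blast
  \<comment> \<open>\<open>c\<close> is the integral of \<open>\<beta> i\<close> over [t - h, t];
    writing it through a primitive gives its derivative, and thus smoothness, at once.\<close>
  define c where "c t = U t - U (t - h)" for t
  have c_deriv: "(c has_real_derivative \<beta> i t - \<beta> i (t - h)) (at t)" for t
    unfolding c_def[abs_def]
    by (auto intro!: derivative_eq_intros DERIV_chain2[OF U] U)
  have smooth_c: "smooth1 c"
    using smooth1_diff[OF smooth[of i] smooth1_affine[OF smooth[of i], of 1 "-h"]]
    by (intro smooth1_if_derivative[OF c_deriv]) simp
  have isCont_\<beta>: "isCont (\<beta> i) t" for t
    using smooth1_continuous[OF smooth[of i]] by (simp add: continuous_on_eq_continuous_at)
  have c_eq: "c t = (\<integral>s. indicator {0..h} s * \<beta> i (t - s) \<partial>lborel)" for t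
  proof -
    have "(\<integral>s. \<beta> i (t - s) * indicator {0..h} s \<partial>lborel) = - U (t - h) - (- U (t - 0))"
    proof (rule integral_FTC_Icc_real[OF h])
      show "((\<lambda>s. - U (t - s)) has_real_derivative \<beta> i (t - s)) (at s)" for s
        by (auto intro!: derivative_eq_intros DERIV_chain2[OF U])
      show "isCont (\<lambda>s. \<beta> i (t - s)) s" for s
        by (rule isCont_o2[where g="\<beta> i"]) (auto intro!: isCont_\<beta> continuous_intros)
    qed
    then show ?thesis by (simp add: c_def mult.commute)
  qed
  \<comment> \<open>Only factor \<open>i\<close> depends on the shift, so integrating \<psi> over
    the segment replaces that factor by \<open>c\<close> and \<Phi> remains a product.\<close>
  define \<Phi> where "\<Phi> = prodfun (\<beta>(i := c))"
  have \<Phi>_eq: "\<Phi> y = (\<integral>s. indicator {0..h} s * \<psi> (y - s *\<^sub>R e) \<partial>lborel)" for y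
  proof -
    have "\<psi> (y - s *\<^sub>R e) = \<beta> i (y $ i - s) * (\<Prod>j\<in>-{i}. \<beta> j (y $ j))" for s
      using prodfun_along_axis[of \<beta> y "-s" i] by (simp add: \<psi>)
    moreover have "\<Phi> y = c (y $ i) * (\<Prod>j\<in>-{i}. \<beta> j (y $ j))"
      using prodfun_along_axis[of "\<beta>(i := c)" y 0 i] by (simp add: \<Phi>_def)
    ultimately show ?thesis
      by (simp add: c_eq mult.assoc[symmetric])
  qed
  have "test_fun \<Omega> \<Phi>"
    unfolding \<Phi>_def
  proof (rule test_fun_prodfun[OF _ _ sub])
    show "smooth1 ((\<beta>(i := c)) j)" for j
      using smooth smooth_c by simp
    show "(\<beta>(i := c)) j t = 0" if t: "t \<notin> {a $ j..(b + h *\<^sub>R e) $ j}" for j t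
    proof (cases "j = i")
      case False
      with t show ?thesis by (auto simp: \<beta>_def axis_def intro!: bump_outside)
    next
      case True
      \<comment> \<open>If \<open>t\<close> lies outside [a_i, b_i + h], then t - s lies outside
        (a_i, b_i) for every s in [0,h]. This is why \<open>sub\<close> prolongs the box by
        \<open>h *\<^sub>R e\<close>.\<close>
      have zero: "(\<lambda>s. indicator {0..h} s * \<beta> i (t - s)) = (\<lambda>_. 0)"
        using t True by (auto simp: fun_eq_iff \<beta>_def indicator_def intro!: bump_outside)
      show ?thesis using True by (simp add: c_eq zero)
    qed
  qed
  from weak[OF this]
  have "(\<integral>x. F x * partial_at i \<Phi> x \<partial>lborel) = (\<integral>x. \<Phi> x \<partial>\<nu>) - (\<integral>x. \<Phi> x \<partial>\<mu>)"
    by simp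
  moreover have "partial_at i \<Phi> x = \<psi> x - \<psi> (x - h *\<^sub>R e)" for x
  proof -
    have "partial_at i \<Phi> x = prodfun (\<beta>(i := \<lambda>t. \<beta> i t - \<beta> i (t - h))) x"
      unfolding \<Phi>_def using prodfun_has_partial(2)[of "\<beta>(i := c)" i] c_deriv by simp
    also have "\<dots> = \<psi> x - \<psi> (x - h *\<^sub>R e)"
      using prodfun_along_axis[of "\<beta>(i := \<lambda>t. \<beta> i t - \<beta> i (t - h))" x 0 i]
        prodfun_along_axis[of \<beta> x 0 i] prodfun_along_axis[of \<beta> x "-h" i]
      by (simp add: \<psi> algebra_simps)
    finally show ?thesis .
  qed
  moreover have "(\<integral>x. \<Phi> x \<partial>M) = (\<integral>x. \<psi> x \<partial>smear e h M)"
    if "finite_measure M" "sets M = sets borel" for M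
  proof -
    have "\<psi> \<in> borel_measurable borel"
      unfolding \<psi> using continuous_on_prodfun[OF smooth1_continuous[OF smooth]]
      by (rule borel_measurable_continuous_onI)
    moreover have "\<bar>\<psi> x\<bar> \<le> 1" for x
      using prodfun_bump_nonneg[of k "($) a" "($) b" x] prodfun_bump_le_1[of k "($) a" "($) b" x]
      by (simp add: \<psi>_def)
    ultimately show ?thesis
      using integral_smear(1)[OF that, of \<psi> 1 e h] by (simp add: \<Phi>_eq)
  qed
  ultimately show ?thesis
    using sets_\<mu> sets_\<nu> finite_\<mu> finite_\<nu> by simp
qed

text \<open>The bumps tend to the indicator of the box. The integrands on the left are dominated by
  2|F|; on the right the constant 1 is integrable because the smeared measures are finite.\<close>

lemma difference_box:
  assumes h: "h \<ge> 0" and sub: "cbox a (b + h *\<^sub>R e) \<subseteq> \<Omega>"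
  defines "I \<equiv> indicator (box a b) :: _ \<Rightarrow> real"
  shows "(\<integral>x. F x * (I x - I (x - h *\<^sub>R e)) \<partial>lborel) =
    measure (smear e h \<nu>) (box a b) - measure (smear e h \<mu>) (box a b)"
proof -
  define \<psi> where "\<psi> k = prodfun (\<lambda>j. bump k (a $ j) (b $ j))" for k
  have \<psi>_bound: "\<bar>\<psi> k x\<bar> \<le> 1" for k x
    using prodfun_bump_nonneg[of k "($) a" "($) b" x] prodfun_bump_le_1[of k "($) a" "($) b" x]
    by (simp add: \<psi>_def)
  have [measurable]: "\<psi> k \<in> borel_measurable borel" for k
    unfolding \<psi>_def
    by (intro borel_measurable_continuous_onI continuous_on_prodfun smooth1_continuous smooth1_bump)
  have [measurable]: "F \<in> borel_measurable borel"
    using integrable_F by auto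
  have lim: "(\<lambda>k. \<psi> k x) \<longlonglongrightarrow> I x" for x
    unfolding \<psi>_def I_def by (rule prodfun_bump_tendsto)
  have "(\<lambda>k. \<integral>x. F x * (\<psi> k x - \<psi> k (x - h *\<^sub>R e)) \<partial>lborel) \<longlonglongrightarrow>
      (\<integral>x. F x * (I x - I (x - h *\<^sub>R e)) \<partial>lborel)"
  proof (rule integral_dominated_convergence[where w="\<lambda>x. 2 * \<bar>F x\<bar>"])
    show "AE x in lborel. norm (F x * (\<psi> k x - \<psi> k (x - h *\<^sub>R e))) \<le> 2 * \<bar>F x\<bar>" for k
    proof (rule AE_I2)
      fix x
      have "\<bar>\<psi> k x - \<psi> k (x - h *\<^sub>R e)\<bar> \<le> 2"
        using \<psi>_bound[of k x] \<psi>_bound[of k "x - h *\<^sub>R e"] by linarith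
      from mult_left_mono[OF this, of "\<bar>F x\<bar>"]
      show "norm (F x * (\<psi> k x - \<psi> k (x - h *\<^sub>R e))) \<le> 2 * \<bar>F x\<bar>"
        by (simp add: abs_mult mult.commute)
    qed
  qed (use integrable_F in \<open>auto simp: I_def intro!: AE_I2 tendsto_intros lim[unfolded I_def]\<close>)
  moreover have "(\<lambda>k. \<integral>x. \<psi> k x \<partial>smear e h M) \<longlonglongrightarrow> measure (smear e h M) (box a b)"
    if "finite_measure M" "sets M = sets borel" for M
  proof -
    interpret finite_measure "smear e h M" using that by (rule finite_measure_smear)
    have "(\<lambda>k. \<integral>x. \<psi> k x \<partial>smear e h M) \<longlonglongrightarrow> (\<integral>x. I x \<partial>smear e h M)"
      by (rule integral_dominated_convergence[where w="\<lambda>_. 1"])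
        (auto simp: I_def \<psi>_bound intro!: AE_I2 lim[unfolded I_def])
    then show ?thesis by (simp add: I_def)
  qed
  then have "(\<lambda>k. (\<integral>x. \<psi> k x \<partial>smear e h \<nu>) - (\<integral>x. \<psi> k x \<partial>smear e h \<mu>)) \<longlonglongrightarrow>
      measure (smear e h \<nu>) (box a b) - measure (smear e h \<mu>) (box a b)"
    using sets_\<mu> sets_\<nu> finite_\<mu> finite_\<nu> by (intro tendsto_diff) auto
  ultimately show ?thesis
    using difference_bump[OF h sub] unfolding \<psi>_def by (intro LIMSEQ_unique) auto
qed

end

section \<open>Difference quotients as averages of the derivative measure\<close>

lemma integrable_imp_set_integrable:
  fixes f :: "'a \<Rightarrow> real"
  shows "integrable M f \<Longrightarrow> B \<in> sets M \<Longrightarrow> set_integrable M B f"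
  unfolding set_integrable_def by (rule integrable_mult_indicator)

lemma set_integral_sums:
  fixes f :: "'a \<Rightarrow> real"
  assumes A: "\<And>n::nat. A n \<in> sets M" and disj: "disjoint_family A" and f: "integrable M f"
  shows "(\<lambda>n. LINT x:A n|M. f x) sums (LINT x:(\<Union>n. A n)|M. f x)"
proof -
  have int: "set_integrable M B f" if "B \<in> sets M" for B
    using f that by (rule integrable_imp_set_integrable)
  have "(\<lambda>n. LINT x:(\<Union>k<n. A k)|M. f x) \<longlonglongrightarrow> (LINT x:(\<Union>n. \<Union>k<n. A k)|M. f x)"
    using A by (intro set_integral_cont_up int) (auto simp: incseq_def, fastforce)
  moreover have "(\<Union>n. \<Union>k<n. A k) = (\<Union>n. A n)" by auto
  moreover have "(LINT x:(\<Union>k<n. A k)|M. f x) = (\<Sum>k<n. LINT x:A k|M. f x)" for n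
    using A disj by (intro set_integral_finite_Union int)
      (auto simp: disjoint_family_on_def)
  ultimately show ?thesis by (simp add: sums_def)
qed

text \<open>This is \<open>B\<close> + \<open>c\<close>, written as a preimage so that it is visibly
  Borel.\<close>

definition translate :: "'a::euclidean_space \<Rightarrow> 'a set \<Rightarrow> 'a set" where
  "translate c B = {x. x - c \<in> B}"

lemma translate_measurable [measurable]:
  assumes [measurable]: "B \<in> sets borel"
  shows "translate c B \<in> sets borel"
proof -
  have "translate c B = (\<lambda>x. x - c) -` B \<inter> space borel" by (auto simp: translate_def)
  also have "\<dots> \<in> sets borel" by measurable
  finally show ?thesis .
qed

context weak_partial begin

abbreviation shift where "shift s \<equiv> translate (s *\<^sub>R e)"

lemma set_integrable_F: "B \<in> sets borel \<Longrightarrow> set_integrable lborel B F"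
  using integrable_F by (intro integrable_imp_set_integrable) auto

text \<open>As functions of \<open>B\<close> both sides are finite signed measures that agree on
  open boxes, an intersection-stable generator of the Borel sets. Cutting with
  \<open>box a b\<close> keeps the segments from x to x + h e inside \<Omega>.\<close>

lemma difference_borel:
  assumes h: "h \<ge> 0" and sub: "cbox a (b + h *\<^sub>R e) \<subseteq> \<Omega>" and B: "B \<in> sets borel"
  shows "(LINT x:(B \<inter> box a b)|lborel. F x) - (LINT x:shift h (B \<inter> box a b)|lborel. F x) =
    measure (smear e h \<nu>) (B \<inter> box a b) - measure (smear e h \<mu>) (B \<inter> box a b)"
proof -
  define P where "P B \<longleftrightarrow>
    (LINT x:(B \<inter> box a b)|lborel. F x) - (LINT x:shift h (B \<inter> box a b)|lborel. F x) =
    measure (smear e h \<nu>) (B \<inter> box a b) - measure (smear e h \<mu>) (B \<inter> box a b)" for B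
  interpret S\<mu>: finite_measure "smear e h \<mu>"
    using finite_\<mu> sets_\<mu> by (rule finite_measure_smear)
  interpret S\<nu>: finite_measure "smear e h \<nu>"
    using finite_\<nu> sets_\<nu> by (rule finite_measure_smear)
  let ?G = "range (\<lambda>(l, u). box l u :: (real^'n) set)"
  have gen: "sets borel = sigma_sets UNIV ?G" by (simp add: borel_eq_box)
  have box: "P (box l u)" for l u
  proof -
    have *: "box l u \<inter> box a b = box (\<Sum>i\<in>Basis. max (l\<bullet>i) (a\<bullet>i) *\<^sub>R i) (\<Sum>i\<in>Basis. min (u\<bullet>i) (b\<bullet>i) *\<^sub>R i)"
      (is "_ = box ?l ?u")
      by (rule box_Int_box)
    have "cbox ?l (?u + h *\<^sub>R e) \<subseteq> cbox a (b + h *\<^sub>R e)"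
      unfolding cbox_interval[symmetric] by (rule subset_box_imp)
        (auto simp: mem_box inner_add_left algebra_simps)
    from difference_box[OF h order.trans[OF this sub]]
    have "(\<integral>x. F x * (indicator (box ?l ?u) x - indicator (box ?l ?u) (x - h *\<^sub>R e)) \<partial>lborel) =
      measure (smear e h \<nu>) (box ?l ?u) - measure (smear e h \<mu>) (box ?l ?u)" .
    moreover have "(\<integral>x. F x * (indicator (box ?l ?u) x - indicator (box ?l ?u) (x - h *\<^sub>R e)) \<partial>lborel) =
      (\<integral>x. indicator (box ?l ?u) x *\<^sub>R F x - indicator (shift h (box ?l ?u)) x *\<^sub>R F x \<partial>lborel)"
      by (intro Bochner_Integration.integral_cong) (auto simp: translate_def indicator_def)
    moreover have "\<dots> = (LINT x:box ?l ?u|lborel. F x) - (LINT x:shift h (box ?l ?u)|lborel. F x)"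
      unfolding set_lebesgue_integral_def
      by (intro Bochner_Integration.integral_diff set_integrable_F[unfolded set_integrable_def]) auto
    ultimately show ?thesis by (simp add: P_def *)
  qed
  have "P B"
  proof (rule sigma_sets_induct_disjoint[of ?G UNIV B P])
    show "Int_stable ?G" by (auto simp: Int_stable_def box_Int_box)
    show "B \<in> sigma_sets UNIV ?G" using B gen by simp
    show "P A" if "A \<in> ?G" for A using that box by auto
    show "P {}" by (simp add: P_def translate_def)
    show "P (UNIV - A)" if A: "A \<in> sigma_sets UNIV ?G" "P A" for A
    proof -
      have [measurable]: "A \<in> sets borel" using A gen by simp
      have eq: "(UNIV - A) \<inter> box a b = box a b - A \<inter> box a b"
        "shift h (box a b - A \<inter> box a b) = shift h (box a b) - shift h (A \<inter> box a b)"
        by (auto simp: translate_def)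
      \<comment> \<open>\<open>box a b\<close> cut with itself gives the total mass, from which that
        of \<open>A\<close> is subtracted.\<close>
      have "P (box a b)" by (rule box)
      have diff: "(LINT x:C - D|lborel. F x) = (LINT x:C|lborel. F x) - (LINT x:D|lborel. F x)"
        if "C \<in> sets borel" "D \<in> sets borel" "D \<subseteq> C" for C D
      proof -
        have "(LINT x:(C - D) \<union> D|lborel. F x) = (LINT x:C - D|lborel. F x) + (LINT x:D|lborel. F x)"
          using that by (intro set_integral_Un set_integrable_F) auto
        moreover have "(C - D) \<union> D = C" using that by auto
        ultimately show ?thesis by simp
      qed
      have "(LINT x:box a b - A \<inter> box a b|lborel. F x) =
          (LINT x:box a b|lborel. F x) - (LINT x:A \<inter> box a b|lborel. F x)"
        by (rule diff) auto
      moreover have "(LINT x:shift h (box a b) - shift h (A \<inter> box a b)|lborel. F x) =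
          (LINT x:shift h (box a b)|lborel. F x) - (LINT x:shift h (A \<inter> box a b)|lborel. F x)"
        by (rule diff) (auto simp: translate_def intro!: translate_measurable[unfolded translate_def])
      moreover have "measure (smear e h \<nu>) (box a b - A \<inter> box a b) =
          measure (smear e h \<nu>) (box a b) - measure (smear e h \<nu>) (A \<inter> box a b)"
        by (rule S\<nu>.finite_measure_Diff) auto
      moreover have "measure (smear e h \<mu>) (box a b - A \<inter> box a b) =
          measure (smear e h \<mu>) (box a b) - measure (smear e h \<mu>) (A \<inter> box a b)"
        by (rule S\<mu>.finite_measure_Diff) auto
      ultimately show ?thesis
        using A(2) \<open>P (box a b)\<close> unfolding P_def eq by simp
    qed
    show "P (\<Union>n. A n)" if A: "disjoint_family A" "range A \<subseteq> sigma_sets UNIV ?G" "\<And>n. P (A n)"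
      for A :: "nat \<Rightarrow> _"
    proof -
      have meas: "A n \<in> sets borel" for n using A gen by auto
      then have m: "A n \<inter> box a b \<in> sets borel" "shift h (A n \<inter> box a b) \<in> sets borel" for n
        by auto
      have disj: "disjoint_family (\<lambda>n. A n \<inter> box a b)" "disjoint_family (\<lambda>n. shift h (A n \<inter> box a b))"
        using A(1) by (auto simp: disjoint_family_on_def translate_def)
      have eq: "(\<Union>n. A n) \<inter> box a b = (\<Union>n. A n \<inter> box a b)"
        "shift h (\<Union>n. A n \<inter> box a b) = (\<Union>n. shift h (A n \<inter> box a b))"
        by (auto simp: translate_def)
      have "(\<lambda>n. (LINT x:A n \<inter> box a b|lborel. F x) - (LINT x:shift h (A n \<inter> box a b)|lborel. F x)) sums
        ((LINT x:(\<Union>n. A n \<inter> box a b)|lborel. F x) - (LINT x:(\<Union>n. shift h (A n \<inter> box a b))|lborel. F x))"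
        using m disj integrable_F by (intro sums_diff set_integral_sums) auto
      moreover have "(\<lambda>n. measure (smear e h \<nu>) (A n \<inter> box a b) - measure (smear e h \<mu>) (A n \<inter> box a b)) sums
        (measure (smear e h \<nu>) (\<Union>n. A n \<inter> box a b) - measure (smear e h \<mu>) (\<Union>n. A n \<inter> box a b))"
        using m disj by (intro sums_diff S\<mu>.finite_measure_UNION S\<nu>.finite_measure_UNION) auto
      ultimately show ?thesis
        using A(3) unfolding P_def eq by (simp add: sums_unique2)
    qed
  qed auto
  then show ?thesis by (simp add: P_def)
qed

lemma set_integral_shift:
  assumes [measurable]: "B \<in> sets borel"
  shows "(LINT x:shift h B|lborel. F x) = (LINT x:B|lborel. F (x + h *\<^sub>R e))"
proof -
  have [measurable]: "F \<in> borel_measurable borel" using integrable_F by auto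
  have "(LINT x:shift h B|lborel. F x) =
      (\<integral>x. indicator (shift h B) x *\<^sub>R F x \<partial>distr lborel borel ((+) (h *\<^sub>R e)))"
    by (simp add: set_lebesgue_integral_def lborel_distr_plus)
  also have "\<dots> = (\<integral>x. indicator (shift h B) (h *\<^sub>R e + x) *\<^sub>R F (h *\<^sub>R e + x) \<partial>lborel)"
    by (subst integral_distr) auto
  also have "\<dots> = (LINT x:B|lborel. F (x + h *\<^sub>R e))"
    unfolding set_lebesgue_integral_def
    by (intro Bochner_Integration.integral_cong) (auto simp: translate_def indicator_def add.commute)
  finally show ?thesis .
qed

lemma measure_smear:
  assumes M: "finite_measure M" "sets M = sets borel" and [measurable]: "B \<in> sets borel"
  shows "measure (smear e h M) B = (\<integral>s. indicator {0..h} s * measure M (shift s B) \<partial>lborel)"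
    and "integrable lborel (\<lambda>s. indicator {0..h} s * measure M (shift s B))"
proof -
  have *: "(\<integral>y. indicator B (y - s *\<^sub>R e) \<partial>M) = measure M (shift s B)" for s
  proof -
    have "(\<lambda>y. indicator B (y - s *\<^sub>R e) :: real) = indicator (shift s B)"
      by (auto simp: translate_def indicator_def)
    moreover have "space M = UNIV" using sets_eq_imp_space_eq[OF M(2)] by simp
    ultimately show ?thesis using M by simp
  qed
  have ind: "\<bar>indicator B x :: real\<bar> \<le> 1" for x by (simp add: indicator_def)
  note smear = integral_smear[OF M borel_measurable_indicator[OF assms(3)] ind]
  show "measure (smear e h M) B = (\<integral>s. indicator {0..h} s * measure M (shift s B) \<partial>lborel)"
    using smear(2) by (simp add: *)
  show "integrable lborel (\<lambda>s. indicator {0..h} s * measure M (shift s B))"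
    using smear(3)[where e = e and h = h] by (simp add: *)
qed

text \<open>By translation invariance the integral of the increment over \<open>B\<close> is the
  integral of \<open>F\<close> over the shifted set minus that over \<open>B\<close>. With signs
  reversed, \<open>difference_borel\<close> expresses this by smeared masses, which are integrals
  over \<open>s\<close> of the masses of the translates.\<close>

lemma difference_quotient_average:
  assumes h: "h > 0" and sub: "cbox a (b + h *\<^sub>R e) \<subseteq> \<Omega>" and B: "B \<in> sets borel" "B \<subseteq> box a b"
  shows "(LINT x:B|lborel. (F (x + h *\<^sub>R e) - F x) / h) =
    (\<integral>s. indicator {0..h} s * (measure \<mu> (shift s B) - measure \<nu> (shift s B)) \<partial>lborel) / h"
    and "integrable lborel (\<lambda>s. indicator {0..h} s * (measure \<mu> (shift s B) - measure \<nu> (shift s B)))"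
proof -
  have [measurable]: "F \<in> borel_measurable borel" using integrable_F by auto
  have "integrable (distr lborel borel ((+) (h *\<^sub>R e))) F"
    using integrable_F by (simp add: lborel_distr_plus)
  then have "integrable lborel (\<lambda>x. F (h *\<^sub>R e + x))"
    by (subst (asm) integrable_distr_eq) auto
  then have "set_integrable lborel B (\<lambda>x. F (x + h *\<^sub>R e))"
    using B by (intro integrable_imp_set_integrable) (auto simp: add.commute)
  then have "(LINT x:B|lborel. (F (x + h *\<^sub>R e) - F x) / h) =
      ((LINT x:B|lborel. F (x + h *\<^sub>R e)) - (LINT x:B|lborel. F x)) / h"
    using B set_integrable_F by (simp add: set_integral_diff)
  also have "\<dots> = (measure (smear e h \<mu>) B - measure (smear e h \<nu>) B) / h"
  proof -
    have "B \<inter> box a b = B" using B by auto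
    then show ?thesis
      using difference_borel[OF less_imp_le[OF h] sub B(1)] set_integral_shift[OF B(1)]
      by (simp add: algebra_simps)
  qed
  also have "measure (smear e h \<mu>) B - measure (smear e h \<nu>) B =
      (\<integral>s. indicator {0..h} s * (measure \<mu> (shift s B) - measure \<nu> (shift s B)) \<partial>lborel)"
    using measure_smear[OF finite_\<mu> sets_\<mu> B(1), of h] measure_smear[OF finite_\<nu> sets_\<nu> B(1), of h]
    by (simp add: right_diff_distrib)
  finally show "(LINT x:B|lborel. (F (x + h *\<^sub>R e) - F x) / h) =
    (\<integral>s. indicator {0..h} s * (measure \<mu> (shift s B) - measure \<nu> (shift s B)) \<partial>lborel) / h" .
  show "integrable lborel (\<lambda>s. indicator {0..h} s * (measure \<mu> (shift s B) - measure \<nu> (shift s B)))"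
    using measure_smear[OF finite_\<mu> sets_\<mu> B(1), of h] measure_smear[OF finite_\<nu> sets_\<nu> B(1), of h]
    by (simp add: right_diff_distrib)
qed

end

section \<open>Limits of averages\<close>

lemma emeasure_translate:
  fixes B :: "'a::euclidean_space set"
  assumes [measurable]: "B \<in> sets borel"
  shows "emeasure lborel (translate c B) = emeasure lborel B"
proof -
  have "emeasure lborel (translate c B) = emeasure (distr lborel borel ((+) c)) (translate c B)"
    by (simp add: lborel_distr_plus)
  also have "\<dots> = emeasure lborel ((+) c -` translate c B)"
    by (subst emeasure_distr) auto
  also have "(+) c -` translate c B = B" by (auto simp: translate_def)
  finally show ?thesis .
qed

lemma set_integral_Diff_Int:
  fixes f :: "'a \<Rightarrow> real"
  assumes "integrable M f" "B \<in> sets M" "C \<in> sets M"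
  shows "(LINT x:B|M. f x) = (LINT x:B - C|M. f x) + (LINT x:B \<inter> C|M. f x)"
proof -
  have "(LINT x:(B - C) \<union> (B \<inter> C)|M. f x) = (LINT x:B - C|M. f x) + (LINT x:B \<inter> C|M. f x)"
    using assms by (intro set_integral_Un integrable_imp_set_integrable) auto
  moreover have "(B - C) \<union> (B \<inter> C) = B" by auto
  ultimately show ?thesis by simp
qed

text \<open>The symmetric difference of \<open>B\<close> and its translate is treated in two halves.
  Outside the closed set \<open>B\<close> the indicator of the translate tends to 0 pointwise, with
  |A| dominating. The part of \<open>B\<close> that the translate misses has the same measure as the
  first half, since translation preserves measure, and there |A| is at most
  \<open>M\<close>.\<close>

lemma set_integral_translate_tendsto:
  fixes A :: "'a::euclidean_space \<Rightarrow> real"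
  assumes A: "integrable lborel A" and B: "compact B" and bound: "\<And>x. x \<in> B \<Longrightarrow> \<bar>A x\<bar> \<le> M"
    and c: "c \<longlonglongrightarrow> 0"
  shows "(\<lambda>k. LINT x:translate (c k) B|lborel. A x) \<longlonglongrightarrow> (LINT x:B|lborel. A x)"
proof -
  define T where "T k = translate (c k) B" for k
  have Bm [measurable]: "B \<in> sets borel" using B by (rule borel_compact)
  have Tm [measurable]: "T k \<in> sets borel" for k by (simp add: T_def)
  have Am [measurable]: "A \<in> borel_measurable borel" using A by auto
  have ptw: "(\<lambda>k. indicator (T k - B) x :: real) \<longlonglongrightarrow> 0" for x
  proof (cases "x \<in> B")
    case False
    have "(\<lambda>k. x - c k) \<longlonglongrightarrow> x - 0" by (intro tendsto_intros c)
    then have "\<forall>\<^sub>F k in sequentially. x - c k \<in> - B"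
      using False compact_imp_closed[OF B] by (intro topological_tendstoD) auto
    then have "\<forall>\<^sub>F k in sequentially. indicator (T k - B) x = (0::real)"
      by eventually_elim (auto simp: T_def translate_def)
    then show ?thesis by (rule tendsto_eventually)
  qed simp
  have lim1: "(\<lambda>k. LINT x:T k - B|lborel. A x) \<longlonglongrightarrow> 0"
  proof -
    have "(\<lambda>k. LINT x:T k - B|lborel. A x) \<longlonglongrightarrow> (\<integral>x. 0 \<partial>(lborel :: 'a measure))"
      unfolding set_lebesgue_integral_def
    proof (rule integral_dominated_convergence[where w="\<lambda>x. \<bar>A x\<bar>"])
      show "AE x in lborel. (\<lambda>k. indicator (T k - B) x *\<^sub>R A x) \<longlonglongrightarrow> 0"
        using tendsto_mult_left_zero[OF ptw] by simp
    qed (use A in \<open>auto simp: indicator_def\<close>)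
    then show ?thesis by simp
  qed
  \<comment> \<open>Boundedness of \<open>B\<close> and of the convergent sequence \<open>c\<close>
    puts all translates into one ball, whose indicator is the dominating function below.\<close>
  obtain R where R: "\<And>x. x \<in> B \<Longrightarrow> norm x \<le> R"
    using compact_imp_bounded[OF B] by (auto simp: bounded_iff)
  obtain K where K: "\<And>k. norm (c k) \<le> K"
    using convergent_imp_Bseq[OF convergentI[OF c]] by (auto simp: Bseq_def)
  have T_sub: "T k \<subseteq> cball 0 (R + K)" for k
  proof
    fix x assume "x \<in> T k"
    then have "norm (x - c k) \<le> R" using R by (simp add: T_def translate_def)
    then show "x \<in> cball 0 (R + K)"
      using K[of k] norm_triangle_sub[of x "c k"] by simp
  qed
  have "(\<lambda>k. \<integral>x. indicator (T k - B) x \<partial>lborel) \<longlonglongrightarrow> (\<integral>x. 0 \<partial>(lborel :: 'a measure) :: real)"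
  proof (rule integral_dominated_convergence[where w="indicator (cball 0 (R + K))"])
    show "integrable lborel (indicator (cball (0::'a) (R + K)) :: _ \<Rightarrow> real)"
      using emeasure_bounded_finite[OF bounded_cball, of "0::'a" "R + K"] by simp
    show "AE x in lborel. norm (indicator (T k - B) x :: real) \<le> indicator (cball 0 (R + K)) x" for k
      using T_sub[of k] by (intro AE_I2) (auto simp: indicator_def subset_eq)
  qed (auto simp: ptw)
  then have lim_meas: "(\<lambda>k. M * measure lborel (T k - B)) \<longlonglongrightarrow> 0"
    by (intro tendsto_mult_right_zero) simp
  have lim2: "(\<lambda>k. LINT x:B - T k|lborel. A x) \<longlonglongrightarrow> 0"
  proof (rule Lim_null_comparison[OF _ lim_meas], rule always_eventually, rule allI)
    fix k
    have fin: "emeasure lborel B \<noteq> \<infinity>" "emeasure lborel (T k) \<noteq> \<infinity>"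
      using emeasure_bounded_finite[OF compact_imp_bounded[OF B]] emeasure_translate[OF Bm, of "c k"]
      by (auto simp: T_def)
    have fm: "B \<in> fmeasurable lborel" "T k \<in> fmeasurable lborel"
      using fin by (auto simp: fmeasurable_def top.not_eq_extremum)
    have "norm (LINT x:B - T k|lborel. A x) \<le> (LINT x:B - T k|lborel. norm (A x))"
      using A by (intro set_integral_norm_bound integrable_imp_set_integrable) auto
    also have "\<dots> \<le> (LINT x:B - T k|lborel. M)"
    proof (rule set_integral_mono)
      show "set_integrable lborel (B - T k) (\<lambda>x. norm (A x))"
        using A by (intro integrable_imp_set_integrable) auto
      have "B - T k \<in> fmeasurable lborel" using fm by (intro fmeasurable.Diff)
      then show "set_integrable lborel (B - T k) (\<lambda>x. M)"
        by (simp add: set_integrable_def fmeasurable_def)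
    qed (use bound in auto)
    also have "\<dots> = M * measure lborel (B - T k)"
      by (simp add: set_lebesgue_integral_def mult.commute)
    also have "measure lborel (B - T k) = measure lborel (T k - B)"
    proof -
      have "measure lborel B + measure lborel (T k - B) = measure lborel (T k) + measure lborel (B - T k)"
        using measure_Un2[OF fm] measure_Un2[OF fm(2,1)] by (simp add: Un_commute)
      moreover have "measure lborel (T k) = measure lborel B"
        using emeasure_translate[OF Bm, of "c k"] by (simp add: measure_def T_def)
      ultimately show ?thesis by simp
    qed
    finally show "norm (LINT x:B - T k|lborel. A x) \<le> M * measure lborel (T k - B)" .
  qed
  have eq: "(LINT x:B|lborel. A x) + ((LINT x:T k - B|lborel. A x) - (LINT x:B - T k|lborel. A x)) =
      (LINT x:T k|lborel. A x)" for k
    using set_integral_Diff_Int[OF A, of B "T k"] set_integral_Diff_Int[OF A, of "T k" B]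
    by (simp add: Int_commute)
  show ?thesis
    using tendsto_add[OF tendsto_const[of "LINT x:B|lborel. A x"] tendsto_diff[OF lim1 lim2]]
    unfolding eq T_def[symmetric] by simp
qed

lemma finite_measure_inner_compact:
  fixes M :: "'a::euclidean_space measure"
  assumes "finite_measure M" and sets: "sets M = sets borel" and N: "N \<in> sets borel" and "\<epsilon> > 0"
  obtains K where "compact K" "K \<subseteq> N" "measure M (N - K) < \<epsilon>"
proof -
  interpret finite_measure M by fact
  have "\<exists>K. compact K \<and> K \<subseteq> N \<and> measure M N - \<epsilon> < measure M K"
  proof (rule ccontr)
    assume "\<not> ?thesis"
    then have le: "measure M K \<le> measure M N - \<epsilon>" if "compact K" "K \<subseteq> N" for K
      using that by (meson not_le)
    \<comment> \<open>The empty set shows that the bound is nonnegative, so that its conversion to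
      \<open>ennreal\<close> does not truncate it.\<close>
    from le[of "{}"] have nn: "0 \<le> measure M N - \<epsilon>" by simp
    have "emeasure M N = (SUP K\<in>{K. K \<subseteq> N \<and> compact K}. emeasure M K)"
      using sets N by (intro inner_regular) auto
    also have "\<dots> \<le> ennreal (measure M N - \<epsilon>)"
      using le by (intro SUP_least) (auto simp: emeasure_eq_measure intro!: ennreal_leI)
    finally have "measure M N \<le> measure M N - \<epsilon>"
      using nn by (simp add: emeasure_eq_measure)
    then show False using \<open>\<epsilon> > 0\<close> by simp
  qed
  then obtain K where K: "compact K" "K \<subseteq> N" "measure M N - \<epsilon> < measure M K" by blast
  have "measure M (N - K) = measure M N - measure M K"
    using K N sets borel_compact[OF K(1)] by (intro finite_measure_Diff) auto
  with K(3) have "measure M (N - K) < \<epsilon>" by linarith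
  with K(1,2) show thesis by (rule that)
qed

section \<open>Difference quotients away from the singular part\<close>

text \<open>\<open>N\<close> carries the singular part: away from it \<mu> - \<nu> has density
  \<open>A\<close>. Fixing one sequence of steps \<open>h\<close> leaves countably many quotients,
  so exceptional null sets can be united.\<close>

locale weak_partial_decomposed = weak_partial \<Omega> F i \<mu> \<nu>
  for \<Omega> :: "(real^'n::finite) set" and F i \<mu> \<nu> +
  fixes A :: "real^'n \<Rightarrow> real" and N :: "(real^'n) set" and h :: "nat \<Rightarrow> real"
  assumes open_\<Omega>: "open \<Omega>" and integrable_A: "integrable lborel A"
    and null_N: "N \<in> null_sets lborel"
    and density: "\<And>C. C \<in> sets borel \<Longrightarrow> C \<subseteq> \<Omega> - N \<Longrightarrow>
      measure \<mu> C - measure \<nu> C = (LINT x:C|lborel. A x)"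
    and h_pos: "\<And>k. h k > 0" and h_lim: "h \<longlonglongrightarrow> 0"
begin

definition shifted_mass where "shifted_mass B s = measure \<mu> (shift s B) - measure \<nu> (shift s B)"

text \<open>Each translate is split at \<open>N\<close>. Off \<open>N\<close> its mass is an
  integral of \<open>A\<close>, which is continuous under translation; within \<open>N\<close> small
  translates miss the compact sets that carry nearly all the mass.\<close>

lemma shifted_mass_tendsto:
  assumes B: "compact B" "B \<subseteq> \<Omega> - N" and bound: "\<And>x. x \<in> B \<Longrightarrow> \<bar>A x\<bar> \<le> M"
  shows "(shifted_mass B \<longlongrightarrow> (LINT x:B|lborel. A x)) (at_right 0)"
  unfolding tendsto_at_iff_sequentially
proof (intro allI impI)
  fix X :: "nat \<Rightarrow> real" assume "\<forall>k. X k \<in> {0<..} - {0}" and X: "X \<longlonglongrightarrow> 0"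
  then have X_pos: "X k > 0" for k by auto
  define T where "T k = shift (X k) B" for k
  have N [measurable]: "N \<in> sets borel" using null_N by auto
  have Bm [measurable]: "B \<in> sets borel" using B(1) by (rule borel_compact)
  have Tm [measurable]: "T k \<in> sets borel" for k by (simp add: T_def)
  have "(\<lambda>k. X k *\<^sub>R e) \<longlonglongrightarrow> 0 *\<^sub>R e" by (intro tendsto_intros X)
  then have lim: "(\<lambda>k. LINT x:T k|lborel. A x) \<longlonglongrightarrow> (LINT x:B|lborel. A x)"
    unfolding T_def by (intro set_integral_translate_tendsto[OF integrable_A B(1) bound]) auto
  interpret \<mu>: finite_measure \<mu> by (rule finite_\<mu>)
  interpret \<nu>: finite_measure \<nu> by (rule finite_\<nu>)
  show "(shifted_mass B \<circ> X) \<longlonglongrightarrow> (LINT x:B|lborel. A x)"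
  proof (rule tendstoI)
    fix \<epsilon> :: real assume "\<epsilon> > 0"
    then have \<epsilon>2: "\<epsilon> / 2 > 0" by simp
    \<comment> \<open>The mass of a translate within \<open>N\<close> will lie in [0, \<epsilon>/2)
      for \<mu> and for \<nu>, so the difference of the two is below \<epsilon>/2, which leaves
      \<epsilon>/2 for the integral of \<open>A\<close>.\<close>
    obtain K1 where K1: "compact K1" "K1 \<subseteq> N" "measure \<mu> (N - K1) < \<epsilon> / 2"
      using finite_measure_inner_compact[OF finite_\<mu> sets_\<mu> N \<epsilon>2] .
    obtain K2 where K2: "compact K2" "K2 \<subseteq> N" "measure \<nu> (N - K2) < \<epsilon> / 2"
      using finite_measure_inner_compact[OF finite_\<nu> sets_\<nu> N \<epsilon>2] .
    have [measurable]: "K1 \<in> sets borel" "K2 \<in> sets borel"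
      using K1 K2 by (auto intro: borel_compact)
    \<comment> \<open>Including the complement of \<Omega> keeps small translates inside \<Omega>,
      as \<open>density\<close> requires.\<close>
    have "closed (K1 \<union> K2 \<union> - \<Omega>)"
      by (intro closed_Un closed_Compl open_\<Omega> compact_imp_closed[OF K1(1)] compact_imp_closed[OF K2(1)])
    moreover have "B \<inter> (K1 \<union> K2 \<union> - \<Omega>) = {}" using B K1 K2 by auto
    ultimately obtain d where d: "d > 0" "\<And>x y. x \<in> B \<Longrightarrow> y \<in> K1 \<union> K2 \<union> - \<Omega> \<Longrightarrow> d \<le> dist x y"
      using separate_compact_closed[OF B(1)] by (metis (no_types))
    have "\<forall>\<^sub>F k in sequentially. X k < d"
      using X d(1) by (rule order_tendstoD)
    moreover have "\<forall>\<^sub>F k in sequentially. dist (LINT x:T k|lborel. A x) (LINT x:B|lborel. A x) < \<epsilon> / 2"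
      using lim \<epsilon>2 by (rule tendstoD)
    ultimately show "\<forall>\<^sub>F k in sequentially. dist ((shifted_mass B \<circ> X) k) (LINT x:B|lborel. A x) < \<epsilon>"
    proof eventually_elim
      case (elim k)
      have avoid: "y \<notin> K1 \<union> K2 \<union> - \<Omega>" if "y \<in> T k" for y
      proof
        assume y: "y \<in> K1 \<union> K2 \<union> - \<Omega>"
        have "d \<le> dist (y - X k *\<^sub>R e) y"
          using that y by (intro d(2)) (auto simp: T_def translate_def)
        also have "\<dots> = X k" using X_pos[of k] by (simp add: dist_norm)
        finally show False using elim by simp
      qed
      have "measure \<mu> (T k \<inter> N) \<le> measure \<mu> (N - K1)" "measure \<nu> (T k \<inter> N) \<le> measure \<nu> (N - K2)"
        using avoid sets_\<mu> sets_\<nu> by (auto intro!: \<mu>.finite_measure_mono \<nu>.finite_measure_mono)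
      moreover have "measure \<mu> (T k) = measure \<mu> (T k - N) + measure \<mu> (T k \<inter> N)"
        "measure \<nu> (T k) = measure \<nu> (T k - N) + measure \<nu> (T k \<inter> N)"
        using sets_\<mu> sets_\<nu> by (simp_all add: \<mu>.finite_measure_Diff' \<nu>.finite_measure_Diff')
      moreover have "measure \<mu> (T k - N) - measure \<nu> (T k - N) = (LINT x:T k|lborel. A x)"
      proof -
        have "measure \<mu> (T k - N) - measure \<nu> (T k - N) = (LINT x:T k - N|lborel. A x)"
          using avoid by (intro density) auto
        also have "\<dots> = (LINT x:T k|lborel. A x)"
          using integrable_A null_N
          by (intro set_integral_null_delta) (auto intro: null_sets_subset)
        finally show ?thesis .
      qed
      moreover have "measure \<mu> (T k \<inter> N) \<ge> 0" "measure \<nu> (T k \<inter> N) \<ge> 0" by simp_all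
      ultimately show ?case
        using K1(3) K2(3) elim(2)
        unfolding shifted_mass_def T_def dist_real_def comp_def by linarith
    qed
  qed
qed

definition D where "D k x = (F (x + h k *\<^sub>R e) - F x) / h k"

lemma cbox_extend:
  assumes sub: "cbox a b \<subseteq> \<Omega>" and ne: "cbox a b \<noteq> {}"
  obtains r where "r > 0" "cbox a (b + r *\<^sub>R e) \<subseteq> \<Omega>"
proof -
  have "cbox a b \<inter> - \<Omega> = {}" using sub by auto
  then obtain d where d: "d > 0" "\<And>x y. x \<in> cbox a b \<Longrightarrow> y \<in> - \<Omega> \<Longrightarrow> d \<le> dist x y"
    using separate_compact_closed[OF compact_cbox closed_Compl[OF open_\<Omega>], of a b] by auto
  have "cbox a (b + (d/2) *\<^sub>R e) \<subseteq> \<Omega>"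
  proof
    fix y assume y: "y \<in> cbox a (b + (d/2) *\<^sub>R e)"
    \<comment> \<open>\<open>t\<close> is the overshoot of \<open>y\<close> beyond the box along
      \<open>e\<close>; moving back by it reaches the box within distance
      \<open>d/2\<close>.\<close>
    define t where "t = max 0 (y $ i - b $ i)"
    have ab: "a $ j \<le> b $ j" for j using ne by (force simp: interval_ne_empty_cart)
    have y': "\<forall>j. a $ j \<le> y $ j \<and> y $ j \<le> (b + (d/2) *\<^sub>R e) $ j"
      using y by (simp add: mem_box_cart)
    have comp: "a $ j \<le> y $ j" "y $ j \<le> b $ j + (if j = i then d/2 else 0)" for j
      using spec[OF y', of j] by (auto simp: axis_def)
    have "y - t *\<^sub>R e \<in> cbox a b"
      unfolding mem_box_cart
    proof
      fix j
      show "a $ j \<le> (y - t *\<^sub>R e) $ j \<and> (y - t *\<^sub>R e) $ j \<le> b $ j"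
        using comp[of j] ab[of j] by (auto simp: t_def axis_def max_def)
    qed
    moreover have "dist (y - t *\<^sub>R e) y < d"
      using comp(2)[of i] d(1) by (auto simp: t_def dist_norm max_def)
    ultimately show "y \<in> \<Omega>" using d(2) by fastforce
  qed
  then show thesis using that[of "d/2"] d(1) by simp
qed

text \<open>The integral is the mean of \<open>shifted_mass B\<close> over [0, h k], and means over
  shrinking intervals converge to the right limit at 0.\<close>

lemma integral_D_tendsto:
  assumes B: "compact B" "B \<subseteq> box a b - N" and sub: "cbox a b \<subseteq> \<Omega>"
    and bound: "\<And>x. x \<in> B \<Longrightarrow> \<bar>A x\<bar> \<le> M"
  shows "(\<lambda>k. LINT x:B|lborel. D k x) \<longlonglongrightarrow> (LINT x:B|lborel. A x)"
proof (cases "B = {}")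
  case False
  define L where "L = (LINT x:B|lborel. A x)"
  have Bm: "B \<in> sets borel" using B(1) by (rule borel_compact)
  have "cbox a b \<noteq> {}" using False B box_subset_cbox by fastforce
  from cbox_extend[OF sub this] obtain r where r: "r > 0" "cbox a (b + r *\<^sub>R e) \<subseteq> \<Omega>" by blast
  have lim: "(shifted_mass B \<longlongrightarrow> L) (at_right 0)"
    unfolding L_def by (rule shifted_mass_tendsto[OF B(1) _ bound]) (use B sub box_subset_cbox[of a b] in auto)
  show ?thesis
    unfolding L_def[symmetric]
  proof (rule LIMSEQ_I)
    fix \<epsilon> :: real assume \<epsilon>: "\<epsilon> > 0"
    have "\<forall>\<^sub>F s in at_right 0. dist (shifted_mass B s) L < \<epsilon> / 2"
      using lim \<epsilon> by (intro tendstoD) auto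
    then obtain \<delta> where \<delta>: "\<delta> > 0" "\<And>s. 0 < s \<Longrightarrow> s < \<delta> \<Longrightarrow> \<bar>shifted_mass B s - L\<bar> < \<epsilon> / 2"
      by (auto simp: eventually_at_right_field dist_real_def)
    have "\<forall>\<^sub>F k in sequentially. h k < min r \<delta>"
      using h_lim r \<delta> by (intro order_tendstoD) auto
    then obtain k0 where k0: "\<And>k. k \<ge> k0 \<Longrightarrow> h k < r \<and> h k < \<delta>"
      by (auto simp: eventually_sequentially)
    show "\<exists>k0. \<forall>k\<ge>k0. norm ((LINT x:B|lborel. D k x) - L) < \<epsilon>"
    proof (intro exI allI impI)
      fix k assume "k \<ge> k0"
      with k0 have k: "h k < r" "h k < \<delta>" by auto
      note hk = h_pos[of k]
      have "cbox a (b + h k *\<^sub>R e) \<subseteq> cbox a (b + r *\<^sub>R e)"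
      proof
        fix x assume x: "x \<in> cbox a (b + h k *\<^sub>R e)"
        have "(b + h k *\<^sub>R e) $ j \<le> (b + r *\<^sub>R e) $ j" for j
          using k by (simp add: axis_def)
        with x show "x \<in> cbox a (b + r *\<^sub>R e)"
          unfolding mem_box_cart by (meson order_trans)
      qed
      then have sub': "cbox a (b + h k *\<^sub>R e) \<subseteq> \<Omega>" using r by blast
      have "B \<subseteq> box a b" using B by auto
      note avg = difference_quotient_average[OF hk sub' Bm this, folded shifted_mass_def]
      have int_ind: "integrable lborel (\<lambda>s. indicator {0..h k} s * (c::real))" for c
        by (intro integrable_mult_left integrable_real_indicator) (auto simp: emeasure_lborel_Icc_eq)
      have "(\<integral>s. indicator {0..h k} s * shifted_mass B s \<partial>lborel) - h k * L =
          (\<integral>s. indicator {0..h k} s * shifted_mass B s - indicator {0..h k} s * L \<partial>lborel)"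
        using avg(2) hk int_ind[of L] by (subst Bochner_Integration.integral_diff) (auto simp: shifted_mass_def)
      also have "\<bar>\<dots>\<bar> \<le> (\<integral>s. indicator {0..h k} s * (\<epsilon> / 2) \<partial>lborel)"
      proof -
        let ?u = "\<lambda>s. indicator {0..h k} s * shifted_mass B s - indicator {0..h k} s * L"
        have int: "integrable lborel ?u"
          using avg(2) int_ind[of L] by (intro Bochner_Integration.integrable_diff) (auto simp: shifted_mass_def)
        \<comment> \<open>The right limit says nothing about \<open>s\<close> = 0, but a single
          point does not affect the integral.\<close>
        have "\<bar>?u s\<bar> \<le> indicator {0..h k} s * (\<epsilon> / 2)" if "s \<noteq> 0" for s
          using that k \<delta>(2)[of s] by (cases "s \<in> {0..h k}") auto
        moreover have "AE s in lborel. s \<noteq> (0::real)" by (rule AE_lborel_singleton)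
        ultimately have "AE s in lborel. \<bar>?u s\<bar> \<le> indicator {0..h k} s * (\<epsilon> / 2)"
          by (auto elim: eventually_mono)
        then have "(\<integral>s. \<bar>?u s\<bar> \<partial>lborel) \<le> (\<integral>s. indicator {0..h k} s * (\<epsilon> / 2) \<partial>lborel)"
          using int int_ind by (intro integral_mono_AE integrable_abs)
        then show ?thesis using integral_abs_bound[of lborel ?u] by linarith
      qed
      also have "\<dots> = h k * (\<epsilon> / 2)" using hk by simp
      finally have *: "\<bar>(\<integral>s. indicator {0..h k} s * shifted_mass B s \<partial>lborel) - h k * L\<bar> \<le> h k * (\<epsilon> / 2)" .
      have "(LINT x:B|lborel. D k x) - L = ((\<integral>s. indicator {0..h k} s * shifted_mass B s \<partial>lborel) - h k * L) / h k"
        using avg(1) hk unfolding D_def[abs_def] by (simp add: diff_divide_distrib shifted_mass_def)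
      then have "\<bar>(LINT x:B|lborel. D k x) - L\<bar> \<le> \<epsilon> / 2"
        using * hk by (simp add: abs_divide divide_le_eq mult.commute)
      then show "norm ((LINT x:B|lborel. D k x) - L) < \<epsilon>" using \<epsilon> by simp
    qed
  qed
qed (simp add: set_lebesgue_integral_def)

end

section \<open>Almost everywhere convergence of the difference quotients\<close>

text \<open>Closed subsets exhaust \<open>S\<close> up to measure \<epsilon>; boundedness makes them
  compact, hence null by assumption.\<close>

lemma null_sets_lborel_if_compact_subsets:
  fixes S :: "'a::euclidean_space set"
  assumes S: "S \<in> sets borel" "bounded S"
    and null: "\<And>B. compact B \<Longrightarrow> B \<subseteq> S \<Longrightarrow> emeasure lborel B = 0"
  shows "S \<in> null_sets lborel"
proof -
  have "emeasure lborel S \<le> ennreal \<epsilon>" if pos: "\<epsilon> > 0" for \<epsilon>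
  proof -
    have Sm: "S \<in> sets lebesgue" using S by auto
    obtain T where T: "closed T" "T \<subseteq> S" "S - T \<in> lmeasurable"
        "emeasure lebesgue (S - T) < ennreal \<epsilon>"
      by (rule sets_lebesgue_inner_closed[OF Sm pos])
    have "compact T"
      using S(2) T(1,2) bounded_subset by (auto simp: compact_eq_bounded_closed)
    have m: "T \<in> sets lborel" "S - T \<in> sets lborel" using T(1) S by auto
    have "(S - T) \<inter> T = {}" "(S - T) \<union> T = S" using T(2) by auto
    with plus_emeasure[OF m(2,1)]
    have "emeasure lborel S = emeasure lborel (S - T) + emeasure lborel T" by simp
    also have "emeasure lborel T = 0"
      using null \<open>compact T\<close> T(2) by blast
    finally have "emeasure lborel S = emeasure lebesgue (S - T)"
      using m(2) by simp
    with T(4) show ?thesis by simp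
  qed
  then have "emeasure lborel S \<le> 0"
    using ennreal_le_epsilon[of 0 "emeasure lborel S"] by simp
  then show ?thesis using S by (simp add: null_sets_def)
qed

context weak_partial_decomposed begin

text \<open>Where the quotients diverge this is an arbitrary value; it is compared with
  \<open>A\<close> only at points where they converge.\<close>

definition G where "G x = lim (\<lambda>k. D k x)"

lemma measurable_F [measurable]: "F \<in> borel_measurable borel"
  using integrable_F by auto

lemma measurable_A [measurable]: "A \<in> borel_measurable borel"
  using integrable_A by auto

lemma measurable_D [measurable]: "D k \<in> borel_measurable borel"
  unfolding D_def[abs_def] by measurable

lemma measurable_G [measurable]: "G \<in> borel_measurable borel"
  unfolding G_def[abs_def] by measurable

text \<open>With \<open>\<sigma> = 1\<close> and \<open>\<sigma> = -1\<close> these sets exhaust the points where the limit differs from the density.\<close>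

definition bad :: "real^'n \<Rightarrow> real^'n \<Rightarrow> real \<Rightarrow> nat \<Rightarrow> nat \<Rightarrow> (real^'n) set" where
  "bad a b \<sigma> n M = {x \<in> box a b - N. \<bar>A x\<bar> \<le> real M \<and> (\<forall>k. \<bar>D k x\<bar> \<le> real M) \<and>
     Cauchy (\<lambda>k. D k x) \<and> 1 / real (Suc n) \<le> \<sigma> * (G x - A x)}"

lemma bad_measurable: "bad a b \<sigma> n M \<in> sets borel"
proof -
  have [measurable]: "N \<in> sets borel" using null_N by auto
  have "bad a b \<sigma> n M = (box a b - N) \<inter> {x \<in> space borel. Cauchy (\<lambda>k. D k x)} \<inter>
     {x \<in> space borel. \<bar>A x\<bar> \<le> real M \<and> (\<forall>k. \<bar>D k x\<bar> \<le> real M) \<and>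
       1 / real (Suc n) \<le> \<sigma> * (G x - A x)}"
    by (auto simp: bad_def)
  also have "\<dots> \<in> sets borel"
    by (intro sets.Int sets_Collect_Cauchy) measurable
  finally show ?thesis .
qed

text \<open>The bound \<open>M\<close> on the quotients allows dominated convergence, and the bound
  on \<open>A\<close> allows \<open>integral_D_tendsto\<close>; both give the limit of the same
  integrals.\<close>

lemma integral_G_eq:
  assumes B: "compact B" "B \<subseteq> bad a b \<sigma> n M" and sub: "cbox a b \<subseteq> \<Omega>"
  shows "(LINT x:B|lborel. G x) = (LINT x:B|lborel. A x)"
    and "set_integrable lborel B G"
proof -
  have Bm [measurable]: "B \<in> sets borel" using B(1) by (rule borel_compact)
  have lim: "(\<lambda>k. D k x) \<longlonglongrightarrow> G x" if "x \<in> B" for x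
    using that B(2) unfolding G_def
    by (intro convergent_LIMSEQ_iff[THEN iffD1] Cauchy_convergent) (auto simp: bad_def)
  have w: "integrable lborel (\<lambda>x. indicator B x * real M)"
    using emeasure_bounded_finite[OF compact_imp_bounded[OF B(1)]]
    by (intro integrable_mult_left integrable_real_indicator) auto
  have ptw: "AE x in lborel. (\<lambda>k. indicator B x *\<^sub>R D k x) \<longlonglongrightarrow> indicator B x *\<^sub>R G x"
    using lim by (intro AE_I2) (auto simp: indicator_def)
  have dom: "AE x in lborel. norm (indicator B x *\<^sub>R D k x) \<le> indicator B x * real M" for k
    using B(2) by (intro AE_I2) (auto simp: indicator_def bad_def)
  have "(\<lambda>k. LINT x:B|lborel. D k x) \<longlonglongrightarrow> (LINT x:B|lborel. G x)"
    unfolding set_lebesgue_integral_def by (rule integral_dominated_convergence[OF _ _ w ptw dom]) measurable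
  moreover have "(\<lambda>k. LINT x:B|lborel. D k x) \<longlonglongrightarrow> (LINT x:B|lborel. A x)"
    using B sub by (intro integral_D_tendsto[where M="real M"]) (auto simp: bad_def)
  ultimately show "(LINT x:B|lborel. G x) = (LINT x:B|lborel. A x)"
    by (rule LIMSEQ_unique)
  show "set_integrable lborel B G"
    unfolding set_integrable_def by (rule integrable_dominated_convergence[OF _ _ w ptw dom]) measurable
qed

text \<open>On a compact subset \<sigma>(G - A) is at least 1/(n+1), yet its integral is zero by
  \<open>integral_G_eq\<close>; so the subset is null.\<close>

lemma null_sets_bad:
  assumes sub: "cbox a b \<subseteq> \<Omega>"
  shows "bad a b \<sigma> n M \<in> null_sets lborel"
proof (rule null_sets_lborel_if_compact_subsets[OF bad_measurable])
  show "bounded (bad a b \<sigma> n M)"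
    by (rule bounded_subset[OF bounded_box[of a b]]) (auto simp: bad_def)
  fix B assume B: "compact B" "B \<subseteq> bad a b \<sigma> n M"
  have Bm [measurable]: "B \<in> sets borel" using B(1) by (rule borel_compact)
  have fin: "emeasure lborel B < \<infinity>"
    using emeasure_bounded_finite[OF compact_imp_bounded[OF B(1)]] by simp
  have iA: "set_integrable lborel B A"
    using integrable_A by (rule integrable_imp_set_integrable) simp
  note GA = integral_G_eq[OF B sub]
  have "measure lborel B * (1 / real (Suc n)) = (LINT x:B|lborel. 1 / real (Suc n))"
    by (simp add: set_lebesgue_integral_def)
  also have "\<dots> \<le> (LINT x:B|lborel. \<sigma> * (G x - A x))"
    using B(2) fin iA GA(2)
    by (intro set_integral_mono set_integrable_mult_right set_integral_diff)
      (auto simp: bad_def set_integrable_def intro!: integrable_mult_left integrable_real_indicator)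
  also have "\<dots> = 0"
    using iA GA by (simp add: set_integral_diff)
  finally have "measure lborel B \<le> 0" by (simp add: divide_le_0_iff)
  then show "emeasure lborel B = 0"
    using fin by (simp add: emeasure_eq_ennreal_measure ennreal_eq_0_iff)
qed

text \<open>Countably many closed boxes cover \<Omega>. In each, discard the boundary,
  \<open>N\<close>, the points of divergence and the countably many bad sets; at every remaining
  point the limit must be \<open>A x\<close>.\<close>

lemma AE_D_tendsto:
  assumes conv: "AE x in lborel. x \<in> \<Omega> \<longrightarrow> convergent (\<lambda>k. D k x)"
  shows "AE x in lborel. x \<in> \<Omega> \<longrightarrow> (\<lambda>k. D k x) \<longlonglongrightarrow> A x"
proof -
  obtain \<D> where \<D>: "countable \<D>" "\<D> \<subseteq> Pow \<Omega>" "\<And>X. X \<in> \<D> \<Longrightarrow> \<exists>a b. X = cbox a b" "\<Union>\<D> = \<Omega>"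
    using open_countable_Union_open_cbox[OF open_\<Omega>] by blast
  have "AE x in lborel. x \<in> X \<longrightarrow> (\<lambda>k. D k x) \<longlonglongrightarrow> A x" if "X \<in> \<D>" for X
  proof -
    obtain a b where X: "X = cbox a b" using \<D>(3) \<open>X \<in> \<D>\<close> by blast
    have sub: "cbox a b \<subseteq> \<Omega>" using \<D>(2) \<open>X \<in> \<D>\<close> X by blast
    have bad_AE: "AE x in lborel. \<forall>n M. x \<notin> bad a b \<sigma> n M" for \<sigma>
      using null_sets_bad[OF sub] by (auto simp: AE_all_countable intro: AE_not_in)
    have "cbox a b - box a b \<in> null_sets lborel"
      by (simp add: null_sets_def emeasure_Diff box_subset_cbox emeasure_lborel_box_eq emeasure_lborel_cbox_eq)
    then have bd: "AE x in lborel. x \<notin> cbox a b - box a b" by (rule AE_not_in)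
    from conv bad_AE[of 1] bad_AE[of "-1"] bd AE_not_in[OF null_N]
    show ?thesis
    proof eventually_elim
      case (elim x)
      show ?case
      proof
        assume "x \<in> X"
        then have x: "x \<in> box a b - N" and cv: "convergent (\<lambda>k. D k x)"
          using elim sub X by auto
        \<comment> \<open>A convergent sequence is bounded, so one natural number bounds |A x| and
          all quotients at \<open>x\<close>.\<close>
        obtain M1 where "\<And>k. \<bar>D k x\<bar> \<le> M1"
          using convergent_imp_Bseq[OF cv] by (auto simp: Bseq_def)
        moreover obtain M where "max \<bar>A x\<bar> M1 \<le> real M"
          using real_arch_simple by blast
        ultimately have M: "\<bar>A x\<bar> \<le> real M" "\<forall>k. \<bar>D k x\<bar> \<le> real M"
          by (auto intro: order_trans)
        have "G x = A x"
        proof (rule ccontr)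
          assume "G x \<noteq> A x"
          then obtain n where n: "1 / real (Suc n) < \<bar>G x - A x\<bar>"
            using reals_Archimedean[of "\<bar>G x - A x\<bar>"] by (auto simp: inverse_eq_divide)
          \<comment> \<open>With this sign \<sigma>(G x - A x) is the absolute difference.\<close>
          define \<sigma> where "\<sigma> = (if G x \<ge> A x then 1 else -1 :: real)"
          have "x \<in> bad a b \<sigma> n M"
            using x M convergent_Cauchy[OF cv] n by (auto simp: bad_def \<sigma>_def abs_if)
          then show False using elim by (auto simp: \<sigma>_def split: if_splits)
        qed
        then show "(\<lambda>k. D k x) \<longlonglongrightarrow> A x"
          using cv by (simp add: G_def convergent_LIMSEQ_iff)
      qed
    qed
  qed
  then have "AE x in lborel. \<forall>X\<in>\<D>. x \<in> X \<longrightarrow> (\<lambda>k. D k x) \<longlonglongrightarrow> A x"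
    by (subst AE_ball_countable[OF \<D>(1)]) blast
  then show ?thesis
    using \<D>(4) by (auto elim!: eventually_mono)
qed

end

section \<open>Borel representatives of Lebesgue measurable data, and the conclusion\<close>

lemma continuous_on_partial_at_test_fun:
  assumes "test_fun \<Omega> \<phi>" shows "continuous_on UNIV (partial_at i \<phi>)"
proof -
  have "continuous_on UNIV (iter_partial [i] \<phi>)"
    using assms unfolding test_fun_def smooth_fun_def by blast
  then show ?thesis by simp
qed

text \<open>Preimages under \<open>u\<close> and \<open>v\<close> differ within a null set, and the
  completion contains all subsets of null sets.\<close>

lemma borel_measurable_completion_AE:
  assumes v: "v \<in> borel_measurable (completion M)" and ae: "AE x in completion M. u x = v x"
  shows "u \<in> borel_measurable (completion M)"
proof (rule measurableI)
  fix B :: "'b set" assume B: "B \<in> sets borel"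
  show "u -` B \<inter> space (completion M) \<in> sets (completion M)"
  proof (rule completion.in_sets_AE)
    show "v -` B \<inter> space (completion M) \<in> sets (completion M)"
      using v B by (rule measurable_sets)
    show "AE x in completion M. x \<in> v -` B \<inter> space (completion M) \<longleftrightarrow> x \<in> u -` B \<inter> space (completion M)"
      using ae by eventually_elim simp
  qed simp
qed simp

lemma has_partial_difference_quotient:
  assumes "has_partial i g x" "h \<longlonglongrightarrow> 0" "\<And>k. h k \<noteq> 0"
  shows "(\<lambda>k. (g (x + h k *\<^sub>R axis i 1) - g x) / h k) \<longlonglongrightarrow> partial_at i g x"
proof -
  have "((\<lambda>t. g (x + t *\<^sub>R axis i 1)) has_real_derivative partial_at i g x) (at 0)"
    using assms(1) unfolding has_partial_def partial_at_def
    by (simp add: DERIV_deriv_iff_real_differentiable)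
  then have "((\<lambda>t. (g (x + t *\<^sub>R axis i 1) - g x) / t) \<longlongrightarrow> partial_at i g x) (at 0)"
    by (simp add: DERIV_def)
  moreover have "filterlim h (at 0) sequentially"
    using assms(2,3) by (simp add: filterlim_at)
  ultimately show ?thesis by (rule filterlim_compose)
qed

text \<open>Extension by zero and alteration on a null set give a Borel function, to which the
  arguments with \<open>lborel\<close> apply.\<close>

lemma set_integrable_lebesgue_borel_version:
  fixes f :: "'a::euclidean_space \<Rightarrow> real"
  assumes "set_integrable lebesgue \<Omega> f"
  obtains F where "integrable lborel F" "AE x in lborel. indicator \<Omega> x * f x = F x"
proof -
  let ?f = "\<lambda>x. indicator \<Omega> x * f x"
  have f: "integrable lebesgue ?f"
    using assms by (simp add: set_integrable_def)
  then obtain F where F: "F \<in> borel_measurable lborel" "AE x in lborel. ?f x = F x"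
    using completion_ex_borel_measurable_real[OF borel_measurable_integrable[OF f]] by auto
  have "integrable lebesgue F"
    using f F by (subst integrable_cong_AE[of _ _ ?f])
      (auto intro: AE_completion measurable_completion borel_measurable_integrable elim: eventually_mono)
  with F that show thesis
    by (simp add: integrable_completion)
qed

theorem theorem9p3p8:
  fixes \<Omega> :: "(real^'n::finite) set" and f g :: "real^'n \<Rightarrow> real"
    and fa :: "real^'n \<Rightarrow> real^'n" and \<mu>p \<mu>n :: "'n \<Rightarrow> (real^'n) measure" and i :: 'n
  assumes "open \<Omega>" and "\<Omega> \<noteq> {}" and "BV \<Omega> f"
    and "\<forall>j. distr_partial \<Omega> f j (\<mu>p j) (\<mu>n j)"
    and "set_integrable lebesgue \<Omega> fa"
    and "\<forall>j. abs_cont_density \<Omega> (\<mu>p j) (\<mu>n j) (\<lambda>x. fa x $ j)"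
    and "AE x in lebesgue. x \<in> \<Omega> \<longrightarrow> g x = f x"
    and "AE x in lebesgue. x \<in> \<Omega> \<longrightarrow> has_partial i g x"
  shows "AE x in lebesgue. x \<in> \<Omega> \<longrightarrow> partial_at i g x = fa x $ i"
proof -
  have f: "set_integrable lebesgue \<Omega> f" using assms(3) by (simp add: BV_def)
  obtain F where F: "integrable lborel F" and F_eq: "AE x in lborel. indicator \<Omega> x * f x = F x"
    using set_integrable_lebesgue_borel_version[OF f] .
  have acd: "abs_cont_density \<Omega> (\<mu>p i) (\<mu>n i) (\<lambda>x. fa x $ i)" using assms(6) by blast
  then have fai: "set_integrable lebesgue \<Omega> (\<lambda>x. fa x $ i)" by (simp add: abs_cont_density_def)
  obtain A where A: "integrable lborel A" and A_eq: "AE x in lborel. indicator \<Omega> x * fa x $ i = A x"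
    using set_integrable_lebesgue_borel_version[OF fai] .
  obtain N0 where N0: "N0 \<in> null_sets lebesgue"
    "\<And>C. C \<in> sets borel \<Longrightarrow> C \<subseteq> \<Omega> - N0 \<Longrightarrow>
      measure (\<mu>p i) C - measure (\<mu>n i) C = (LINT x:C|lebesgue. fa x $ i)"
    using acd unfolding abs_cont_density_def by blast
  \<comment> \<open>Enlarging \<open>N0\<close> to a Borel null set only shrinks the family of sets
    \<open>C\<close> for which the density formula is claimed.\<close>
  then obtain N where N: "N \<in> null_sets lborel" "N0 \<subseteq> N"
    by (auto simp: null_sets_completion_iff2)
  have dp: "distr_partial \<Omega> f i (\<mu>p i) (\<mu>n i)" using assms(4) by blast
  then have "fin_meas_on \<Omega> (\<mu>p i)" "fin_meas_on \<Omega> (\<mu>n i)" unfolding distr_partial_def by blast+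
  then have meas: "sets (\<mu>p i) = sets borel" "sets (\<mu>n i) = sets borel"
    "finite_measure (\<mu>p i)" "finite_measure (\<mu>n i)"
    unfolding fin_meas_on_def by blast+
  have [measurable]: "F \<in> borel_measurable borel" "A \<in> borel_measurable borel"
    using F A by auto
  \<comment> \<open>Integrals depend on a function only up to null sets, and completing the measure
    leaves integrals of Borel functions unchanged.\<close>
  have transfer: "integral\<^sup>L lebesgue u = integral\<^sup>L lborel v"
    if "AE x in lborel. u x = v x" "v \<in> borel_measurable borel" for u v :: "real^'n \<Rightarrow> real"
  proof -
    have v: "v \<in> borel_measurable lebesgue" using that(2) by (simp add: measurable_completion)
    have ae: "AE x in lebesgue. u x = v x" using that(1) by (rule AE_completion)
    have "u \<in> borel_measurable lebesgue"
      using v ae by (rule borel_measurable_completion_AE)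
    then have "integral\<^sup>L lebesgue u = integral\<^sup>L lebesgue v"
      using ae v by (intro integral_cong_AE)
    also have "\<dots> = integral\<^sup>L lborel v" using that(2) by (simp add: integral_completion)
    finally show ?thesis .
  qed
  define h where "h k = inverse (real (Suc k))" for k
  interpret weak_partial_decomposed \<Omega> F i "\<mu>p i" "\<mu>n i" A N h
  proof (intro weak_partial_decomposed.intro weak_partial.intro weak_partial_decomposed_axioms.intro)
    show "(\<integral>x. F x * partial_at i \<phi> x \<partial>lborel) = - ((\<integral>x. \<phi> x \<partial>\<mu>p i) - (\<integral>x. \<phi> x \<partial>\<mu>n i))"
      if "test_fun \<Omega> \<phi>" for \<phi>
    proof -
      have [measurable]: "partial_at i \<phi> \<in> borel_measurable borel"
        using that by (intro borel_measurable_continuous_onI continuous_on_partial_at_test_fun)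
      have "(LINT x:\<Omega>|lebesgue. f x * partial_at i \<phi> x) = (\<integral>x. F x * partial_at i \<phi> x \<partial>lborel)"
        unfolding set_lebesgue_integral_def
        by (rule transfer) (use F_eq in \<open>auto elim!: eventually_mono\<close>)
      then show ?thesis using dp that by (simp add: distr_partial_def)
    qed
    show "measure (\<mu>p i) C - measure (\<mu>n i) C = (LINT x:C|lborel. A x)"
      if C: "C \<in> sets borel" "C \<subseteq> \<Omega> - N" for C
    proof -
      have [measurable]: "C \<in> sets borel" by fact
      have "(LINT x:C|lebesgue. fa x $ i) = (LINT x:C|lborel. A x)"
        unfolding set_lebesgue_integral_def
      proof (rule transfer)
        show "AE x in lborel. indicator C x *\<^sub>R fa x $ i = indicator C x *\<^sub>R A x"
          using A_eq by eventually_elim (use C(2) in \<open>auto simp: indicator_def split: if_splits\<close>)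
      qed measurable
      moreover have "C \<subseteq> \<Omega> - N0" using C(2) N(2) by blast
      ultimately show ?thesis using N0(2)[OF C(1)] by simp
    qed
    show "h \<longlonglongrightarrow> 0" unfolding h_def by (rule LIMSEQ_inverse_real_of_nat)
  qed (simp_all add: meas assms(1) F A N(1) h_def)
  have g_eq: "AE x in lborel. x \<in> \<Omega> \<longrightarrow> g x = F x"
  proof -
    have "AE x in lborel. x \<in> \<Omega> \<longrightarrow> g x = f x" using assms(7) by (simp add: AE_completion_iff)
    with F_eq show ?thesis by eventually_elim auto
  qed
  then obtain E where E: "E \<in> null_sets lborel" "\<And>x. x \<in> \<Omega> \<Longrightarrow> x \<notin> E \<Longrightarrow> g x = F x"
    by (auto simp: eventually_ae_filter)
  \<comment> \<open>Translates of the null set \<open>E\<close> are null and there are countably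
    many steps, so for almost every \<open>x\<close> no point x + h k e lies in
    \<open>E\<close>.\<close>
  have "AE x in lborel. x + h k *\<^sub>R e \<notin> E" for k
  proof -
    have "translate (- (h k *\<^sub>R e)) E \<in> null_sets lborel"
      using E(1) by (auto simp: null_sets_def emeasure_translate)
    from AE_not_in[OF this] show ?thesis by (simp add: translate_def)
  qed
  then have shift_E: "AE x in lborel. \<forall>k. x + h k *\<^sub>R e \<notin> E" by (simp add: AE_all_countable)
  have partial_AE: "AE x in lborel. x \<in> \<Omega> \<longrightarrow> has_partial i g x"
    using assms(8) by (simp add: AE_completion_iff)
  have lim: "AE x in lborel. x \<in> \<Omega> \<longrightarrow> (\<lambda>k. D k x) \<longlonglongrightarrow> partial_at i g x"
    using shift_E partial_AE AE_not_in[OF E(1)]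
  proof eventually_elim
    case (elim x)
    show ?case
    proof
      assume x: "x \<in> \<Omega>"
      \<comment> \<open>Openness puts x + h k e into \<Omega> for large \<open>k\<close>, where
        avoiding \<open>E\<close> makes \<open>g\<close> and \<open>F\<close> agree; the quotients
        of the two eventually coincide.\<close>
      have "(\<lambda>k. x + h k *\<^sub>R e) \<longlonglongrightarrow> x + 0 *\<^sub>R e" by (intro tendsto_intros h_lim)
      then have "\<forall>\<^sub>F k in sequentially. x + h k *\<^sub>R e \<in> \<Omega>"
        using x by (intro topological_tendstoD[OF _ assms(1)]) auto
      then have "\<forall>\<^sub>F k in sequentially. (g (x + h k *\<^sub>R e) - g x) / h k = D k x"
        by eventually_elim (use elim x E(2) in \<open>simp add: D_def\<close>)
      moreover have "(\<lambda>k. (g (x + h k *\<^sub>R e) - g x) / h k) \<longlonglongrightarrow> partial_at i g x"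
        using elim x h_lim h_pos by (intro has_partial_difference_quotient) (auto simp: less_imp_neq[symmetric])
      ultimately show "(\<lambda>k. D k x) \<longlonglongrightarrow> partial_at i g x"
        by (rule Lim_transform_eventually[rotated])
    qed
  qed
  then have "AE x in lborel. x \<in> \<Omega> \<longrightarrow> convergent (\<lambda>k. D k x)"
    by eventually_elim (auto simp: convergent_def)
  \<comment> \<open>The same quotients tend to \<open>A x\<close> and to the partial derivative of
    \<open>g\<close>; on \<Omega> the former is almost everywhere \<open>fa x $ i\<close>.\<close>
  from AE_D_tendsto[OF this] lim A_eq
  have "AE x in lborel. x \<in> \<Omega> \<longrightarrow> partial_at i g x = fa x $ i"
    by eventually_elim (auto dest: LIMSEQ_unique)
  then show ?thesis by (rule AE_completion)
qed

end
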